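(* Let $C$ be a Rota-Baxter coalgebra (respectively, a noncounitary Rota-Baxter coalgebra) of weight $\lambda\in\mathbb{K}$, with coproduct $\Delta$ and Rota-Baxter operator $P$. Then the linear dual $C^\ast$, together with the linear dual $P^\ast$ of the Rota-Baxter operator, is a Rota-Baxter algebra (respectively, a nonunitary Rota-Baxter algebra) of weight $\lambda$.
   Context: $\mathbb{K}$ is a fixed ground field of characteristic 0; all vector spaces, algebras, coalgebras and tensor products are over $\mathbb{K}$. A Rota-Baxter coalgebra of weight $\lambda\in\mathbb{K}$ is a (coassociative, counital) coalgebra $(C,\Delta,\varepsilon)$ equipped with a linear operator $P:C\to C$ such that $(P\otimes P)\Delta=(\mathrm{id}\otimes P)\Delta P+(P\otimes\mathrm{id})\Delta P+\lambda\Delta P$. A noncounitary Rota-Baxter coalgebra $(C,\Delta,P)$ is the same with $(C,\Delta)$ a noncounitary coalgebra, i.e. $\Delta$ is coassociative but no counit is required. A Rota-Baxter algebra of weight $\lambda$ is a pair $(R,Q)$ of an associative algebra $R$ and a linear endomorphism $Q$ of $R$ with $Q(x)Q(y)=Q(xQ(y))+Q(Q(x)y)+\lambda Q(xy)$ for all $x,y\in R$; it is nonunitary if no unit of $R$ is required, and otherwise $R$ has a unit. $C^\ast=\mathrm{Hom}_{\mathbb{K}}(C,\mathbb{K})$ carries the usual dual (convolution) product $(fg)(c)=\sum f(c_{(1)})g(c_{(2)})$, where $\Delta(c)=\sum c_{(1)}\otimes c_{(2)}$, with unit $\varepsilon$ in the counital case, and $P^\ast(f)=f\circ P$. *)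

theory Defs
  imports "HOL-Algebra.Module" "HOL-Algebra.AbelCoset"
begin

section \<open>Linear maps and quotient modules\<close>

text \<open>Modules live on a carrier set, so the values of a linear map outside the carrier of its
  domain are irrelevant.  Several records below leave the fields \<open>mult\<close> and \<open>one\<close>, which
  module records inherit from ring records, unspecified.\<close>

definition linear_maps ::
    "('k, 'r) ring_scheme \<Rightarrow> ('k, 'a, 'm) module_scheme \<Rightarrow> ('k, 'b, 'n) module_scheme \<Rightarrow> ('a \<Rightarrow> 'b) set"
  where "linear_maps K M N = {h \<in> carrier M \<rightarrow> carrier N.
    (\<forall>x \<in> carrier M. \<forall>y \<in> carrier M. h (x \<oplus>\<^bsub>M\<^esub> y) = h x \<oplus>\<^bsub>N\<^esub> h y) \<and>
    (\<forall>a \<in> carrier K. \<forall>x \<in> carrier M. h (a \<odot>\<^bsub>M\<^esub> x) = a \<odot>\<^bsub>N\<^esub> h x)}"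

definition ground_module :: "('k, 'r) ring_scheme \<Rightarrow> ('k, 'k) module"
  where "ground_module K = \<lparr>carrier = carrier K, mult = mult K, one = one K,
    zero = zero K, add = add K, smult = mult K\<rparr>"

definition quotient_module :: "('k, 'a, 'm) module_scheme \<Rightarrow> 'a set \<Rightarrow> ('k, 'a set) module"
  where "quotient_module M N = \<lparr>carrier = a_rcosets\<^bsub>M\<^esub> N, mult = undefined, one = undefined,
    zero = N, add = set_add M, smult = (\<lambda>a X. \<Union>x\<in>X. N +>\<^bsub>M\<^esub> (a \<odot>\<^bsub>M\<^esub> x))\<rparr>"


section \<open>Tensor products\<close>

definition free_module :: "('k, 'r) ring_scheme \<Rightarrow> 'x set \<Rightarrow> ('k, 'x \<Rightarrow> 'k) module"
  where "free_module K X = \<lparr>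
    carrier = {\<phi>. (\<forall>x. \<phi> x \<in> carrier K) \<and> finite {x. \<phi> x \<noteq> \<zero>\<^bsub>K\<^esub>} \<and> {x. \<phi> x \<noteq> \<zero>\<^bsub>K\<^esub>} \<subseteq> X},
    mult = undefined, one = undefined,
    zero = (\<lambda>x. \<zero>\<^bsub>K\<^esub>),
    add = (\<lambda>\<phi> \<psi> x. \<phi> x \<oplus>\<^bsub>K\<^esub> \<psi> x),
    smult = (\<lambda>a \<phi> x. a \<otimes>\<^bsub>K\<^esub> \<phi> x)\<rparr>"

definition free_gen :: "('k, 'r) ring_scheme \<Rightarrow> 'x \<Rightarrow> 'x \<Rightarrow> 'k"
  where "free_gen K x = (\<lambda>y. if y = x then \<one>\<^bsub>K\<^esub> else \<zero>\<^bsub>K\<^esub>)"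

definition tensor_relators ::
    "('k, 'r) ring_scheme \<Rightarrow> ('k, 'a, 'm) module_scheme \<Rightarrow> ('k, 'b, 'n) module_scheme \<Rightarrow>
      ('a \<times> 'b \<Rightarrow> 'k) set"
  where "tensor_relators K M N = (let F = free_module K (carrier M \<times> carrier N); e = free_gen K in
      {e (x \<oplus>\<^bsub>M\<^esub> x', y) \<ominus>\<^bsub>F\<^esub> (e (x, y) \<oplus>\<^bsub>F\<^esub> e (x', y)) | x x' y.
        x \<in> carrier M \<and> x' \<in> carrier M \<and> y \<in> carrier N} \<union>
      {e (x, y \<oplus>\<^bsub>N\<^esub> y') \<ominus>\<^bsub>F\<^esub> (e (x, y) \<oplus>\<^bsub>F\<^esub> e (x, y')) | x y y'.
        x \<in> carrier M \<and> y \<in> carrier N \<and> y' \<in> carrier N} \<union>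
      {e (a \<odot>\<^bsub>M\<^esub> x, y) \<ominus>\<^bsub>F\<^esub> (a \<odot>\<^bsub>F\<^esub> e (x, y)) | a x y.
        a \<in> carrier K \<and> x \<in> carrier M \<and> y \<in> carrier N} \<union>
      {e (x, a \<odot>\<^bsub>N\<^esub> y) \<ominus>\<^bsub>F\<^esub> (a \<odot>\<^bsub>F\<^esub> e (x, y)) | a x y.
        a \<in> carrier K \<and> x \<in> carrier M \<and> y \<in> carrier N})"

definition tensor_kernel ::
    "('k, 'r) ring_scheme \<Rightarrow> ('k, 'a, 'm) module_scheme \<Rightarrow> ('k, 'b, 'n) module_scheme \<Rightarrow>
      ('a \<times> 'b \<Rightarrow> 'k) set"
  where "tensor_kernel K M N = \<Inter> {H. submodule H K (free_module K (carrier M \<times> carrier N)) \<and>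
    tensor_relators K M N \<subseteq> H}"

definition tensor ::
    "('k, 'r) ring_scheme \<Rightarrow> ('k, 'a, 'm) module_scheme \<Rightarrow> ('k, 'b, 'n) module_scheme \<Rightarrow>
      ('k, ('a \<times> 'b \<Rightarrow> 'k) set) module"
  where "tensor K M N =
    quotient_module (free_module K (carrier M \<times> carrier N)) (tensor_kernel K M N)"

definition pure_tensor ::
    "('k, 'r) ring_scheme \<Rightarrow> ('k, 'a, 'm) module_scheme \<Rightarrow> ('k, 'b, 'n) module_scheme \<Rightarrow>
      'a \<Rightarrow> 'b \<Rightarrow> ('a \<times> 'b \<Rightarrow> 'k) set"
  where "pure_tensor K M N x y =
    tensor_kernel K M N +>\<^bsub>free_module K (carrier M \<times> carrier N)\<^esub> free_gen K (x, y)"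

definition bilinear_map ::
    "('k, 'r) ring_scheme \<Rightarrow> ('k, 'a, 'm) module_scheme \<Rightarrow> ('k, 'b, 'n) module_scheme \<Rightarrow>
      ('k, 'w, 'o) module_scheme \<Rightarrow> ('a \<Rightarrow> 'b \<Rightarrow> 'w) \<Rightarrow> bool"
  where "bilinear_map K M N W \<beta> \<longleftrightarrow>
    (\<forall>y \<in> carrier N. (\<lambda>x. \<beta> x y) \<in> linear_maps K M W) \<and>
    (\<forall>x \<in> carrier M. \<beta> x \<in> linear_maps K N W)"

text \<open>The linear map on a tensor product, with values in \<open>W\<close>, that is induced by a bilinear map
  \<open>\<beta>\<close>: the linear extension of \<open>\<beta>\<close> to the free module is constant on every coset \<open>X\<close>
  (see \<open>tensor_lift_pure\<close>, \<open>tensor_lift_linear\<close> and \<open>tensor_linear_eqI\<close> below).\<close>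

definition free_extend ::
    "('k, 'r) ring_scheme \<Rightarrow> ('k, 'w, 'm) module_scheme \<Rightarrow> ('x \<Rightarrow> 'w) \<Rightarrow> ('x \<Rightarrow> 'k) \<Rightarrow> 'w"
  where "free_extend K W b \<phi> = (\<Oplus>\<^bsub>W\<^esub>x \<in> {x. \<phi> x \<noteq> \<zero>\<^bsub>K\<^esub>}. \<phi> x \<odot>\<^bsub>W\<^esub> b x)"

definition tensor_lift ::
    "('k, 'r) ring_scheme \<Rightarrow> ('k, 'w, 'm) module_scheme \<Rightarrow> ('a \<Rightarrow> 'b \<Rightarrow> 'w) \<Rightarrow>
      ('a \<times> 'b \<Rightarrow> 'k) set \<Rightarrow> 'w"
  where "tensor_lift K W \<beta> X = the_elem (free_extend K W (case_prod \<beta>) ` X)"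



section \<open>Universal property of the tensor product\<close>

lemma free_module_simps [simp]:
  "zero (free_module K X) = (\<lambda>x. \<zero>\<^bsub>K\<^esub>)"
  "add (free_module K X) = (\<lambda>\<phi> \<psi> x. \<phi> x \<oplus>\<^bsub>K\<^esub> \<psi> x)"
  "smult (free_module K X) = (\<lambda>a \<phi> x. a \<otimes>\<^bsub>K\<^esub> \<phi> x)"
  by (simp_all add: free_module_def)

lemma free_module_carrier_iff:
  "\<phi> \<in> carrier (free_module K X) \<longleftrightarrow>
    (\<forall>x. \<phi> x \<in> carrier K) \<and> finite {x. \<phi> x \<noteq> \<zero>\<^bsub>K\<^esub>} \<and> {x. \<phi> x \<noteq> \<zero>\<^bsub>K\<^esub>} \<subseteq> X"
  by (simp add: free_module_def)

lemma free_module_module: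
  assumes "cring K" shows "module K (free_module K X)"
proof -
  interpret K: cring K by fact
  have sub: "{x. \<phi> x \<oplus>\<^bsub>K\<^esub> \<psi> x \<noteq> \<zero>\<^bsub>K\<^esub>} \<subseteq> {x. \<phi> x \<noteq> \<zero>\<^bsub>K\<^esub>} \<union> {x. \<psi> x \<noteq> \<zero>\<^bsub>K\<^esub>}" for \<phi> \<psi>
    by auto
  have add: "(\<lambda>x. \<phi> x \<oplus>\<^bsub>K\<^esub> \<psi> x) \<in> carrier (free_module K X)"
    if "\<phi> \<in> carrier (free_module K X)" "\<psi> \<in> carrier (free_module K X)" for \<phi> \<psi>
    using that sub[of \<phi> \<psi>] unfolding free_module_carrier_iff
    by (meson K.add.m_closed finite_UnI finite_subset le_sup_iff order_trans sup_least)
  have sm: "(\<lambda>x. a \<otimes>\<^bsub>K\<^esub> \<phi> x) \<in> carrier (free_module K X)"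
    if "\<phi> \<in> carrier (free_module K X)" "a \<in> carrier K" for \<phi> a
  proof -
    have "{x. a \<otimes>\<^bsub>K\<^esub> \<phi> x \<noteq> \<zero>\<^bsub>K\<^esub>} \<subseteq> {x. \<phi> x \<noteq> \<zero>\<^bsub>K\<^esub>}" using that by auto
    with that show ?thesis unfolding free_module_carrier_iff
      by (auto intro: finite_subset)
  qed
  show ?thesis
  proof (rule moduleI)
    show "abelian_group (free_module K X)"
    proof (rule abelian_groupI)
      fix \<phi> assume \<phi>: "\<phi> \<in> carrier (free_module K X)"
      have e: "(\<lambda>x. \<ominus>\<^bsub>K\<^esub> \<phi> x) = (\<lambda>x. (\<ominus>\<^bsub>K\<^esub> \<one>\<^bsub>K\<^esub>) \<otimes>\<^bsub>K\<^esub> \<phi> x)"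
        using \<phi> by (auto simp: free_module_carrier_iff K.l_minus)
      have "(\<lambda>x. \<ominus>\<^bsub>K\<^esub> \<phi> x) \<in> carrier (free_module K X)"
        unfolding e by (rule sm[OF \<phi>]) simp
      moreover have "(\<lambda>x. \<ominus>\<^bsub>K\<^esub> \<phi> x \<oplus>\<^bsub>K\<^esub> \<phi> x) = (\<lambda>x. \<zero>\<^bsub>K\<^esub>)"
        using \<phi> by (auto simp: free_module_carrier_iff K.l_neg)
      ultimately show "\<exists>y\<in>carrier (free_module K X). y \<oplus>\<^bsub>free_module K X\<^esub> \<phi> = \<zero>\<^bsub>free_module K X\<^esub>"
        by auto
    next
      fix \<phi> \<psi> assume "\<phi> \<in> carrier (free_module K X)" "\<psi> \<in> carrier (free_module K X)"
      then show "\<phi> \<oplus>\<^bsub>free_module K X\<^esub> \<psi> \<in> carrier (free_module K X)" by (simp add: add)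
    qed (auto simp: free_module_carrier_iff K.a_ac)
  next
    fix a \<phi> assume "a \<in> carrier K" "\<phi> \<in> carrier (free_module K X)"
    then show "a \<odot>\<^bsub>free_module K X\<^esub> \<phi> \<in> carrier (free_module K X)" by (simp add: sm)
  qed (auto simp: assms free_module_carrier_iff K.l_distr K.r_distr K.m_assoc)
qed

lemma free_gen_carrier:
  assumes "cring K" "x \<in> X" shows "free_gen K x \<in> carrier (free_module K X)"
proof -
  interpret K: cring K by fact
  have "{y. free_gen K x y \<noteq> \<zero>\<^bsub>K\<^esub>} \<subseteq> {x}" by (auto simp: free_gen_def)
  with assms(2) show ?thesis unfolding free_module_carrier_iff
    by (auto simp: free_gen_def intro: finite_subset)
qed

lemma quotient_module_simps [simp]:
  "carrier (quotient_module M N) = a_rcosets\<^bsub>M\<^esub> N"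
  "zero (quotient_module M N) = N"
  "add (quotient_module M N) = set_add M"
  "smult (quotient_module M N) a X = (\<Union>x\<in>X. N +>\<^bsub>M\<^esub> (a \<odot>\<^bsub>M\<^esub> x))"
  by (simp_all add: quotient_module_def)

lemma comm_group_extend:
  assumes "comm_group \<lparr>carrier = A, mult = m, one = e\<rparr>"
  shows "comm_group \<lparr>carrier = A, mult = m, one = e, \<dots> = z\<rparr>"
proof -
  interpret comm_group "\<lparr>carrier = A, mult = m, one = e\<rparr>" by fact
  show ?thesis
    using m_assoc m_comm l_inv_ex m_closed one_closed l_one by (intro comm_groupI) auto
qed

context module begin

lemma submodule_abelian_subgroup: "submodule N R M \<Longrightarrow> abelian_subgroup N M"
  by (rule abelian_subgroupI3) (auto simp: additive_subgroup_def submodule_def M.abelian_group_axioms)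

lemma quotient_smult_coset:
  assumes N: "submodule N R M" and a: "a \<in> carrier R" and x: "x \<in> carrier M"
  shows "smult (quotient_module M N) a (N +>\<^bsub>M\<^esub> x) = N +>\<^bsub>M\<^esub> (a \<odot>\<^bsub>M\<^esub> x)"
proof -
  interpret N: abelian_subgroup N M using submodule_abelian_subgroup[OF N] .
  have "N +>\<^bsub>M\<^esub> (a \<odot>\<^bsub>M\<^esub> y) = N +>\<^bsub>M\<^esub> (a \<odot>\<^bsub>M\<^esub> x)" if y: "y \<in> N +>\<^bsub>M\<^esub> x" for y
  proof -
    from y obtain n where n: "n \<in> N" and yn: "y = n \<oplus>\<^bsub>M\<^esub> x" by (auto simp: a_r_coset_def')
    have nM: "n \<in> carrier M" using n N.a_subset by auto
    have "a \<odot>\<^bsub>M\<^esub> y = a \<odot>\<^bsub>M\<^esub> n \<oplus>\<^bsub>M\<^esub> a \<odot>\<^bsub>M\<^esub> x" using yn a x nM smult_r_distr by simp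
    moreover have "a \<odot>\<^bsub>M\<^esub> n \<in> N" using submoduleE(4)[OF N a n] .
    ultimately have "a \<odot>\<^bsub>M\<^esub> y \<in> N +>\<^bsub>M\<^esub> (a \<odot>\<^bsub>M\<^esub> x)" by (auto simp: a_r_coset_def')
    then show ?thesis using N.a_repr_independence' a x smult_closed by metis
  qed
  moreover have "x \<in> N +>\<^bsub>M\<^esub> x" using N.a_rcos_self x by simp
  ultimately show ?thesis unfolding quotient_module_simps by blast
qed

lemma quotient_add_coset:
  assumes N: "submodule N R M" and x: "x \<in> carrier M" and y: "y \<in> carrier M"
  shows "(N +>\<^bsub>M\<^esub> x) \<oplus>\<^bsub>quotient_module M N\<^esub> (N +>\<^bsub>M\<^esub> y) = N +>\<^bsub>M\<^esub> (x \<oplus>\<^bsub>M\<^esub> y)"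
proof -
  interpret N: abelian_subgroup N M using submodule_abelian_subgroup[OF N] .
  show ?thesis using N.a_rcos_sum x y by simp
qed

lemma quotient_module_module:
  assumes N: "submodule N R M"
  shows "module R (quotient_module M N)"
proof -
  interpret N: abelian_subgroup N M using submodule_abelian_subgroup[OF N] .
  have rc: "\<exists>x\<in>carrier M. X = N +>\<^bsub>M\<^esub> x" if "X \<in> a_rcosets\<^bsub>M\<^esub> N" for X
    using that by (auto simp: A_RCOSETS_def')
  have rcI: "N +>\<^bsub>M\<^esub> x \<in> a_rcosets\<^bsub>M\<^esub> N" if "x \<in> carrier M" for x
    using that by (auto simp: A_RCOSETS_def')
  note sc = quotient_smult_coset[OF N]
  note ac = quotient_add_coset[OF N]
  show ?thesis
  proof (rule moduleI)
    show "cring R" by (rule R.is_cring)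
    show "abelian_group (quotient_module M N)"
      by (rule comm_group_abelian_groupI)
        (use N.a_factorgroup_is_comm_group in
          \<open>simp add: A_FactGroup_def' quotient_module_def comm_group_extend\<close>)
  next
    fix a X assume "a \<in> carrier R" "X \<in> carrier (quotient_module M N)"
    then show "a \<odot>\<^bsub>quotient_module M N\<^esub> X \<in> carrier (quotient_module M N)"
      using rc[of X] rcI sc[of a] by (auto simp del: quotient_module_simps(4))
  next
    fix a b X assume "a \<in> carrier R" "b \<in> carrier R" "X \<in> carrier (quotient_module M N)"
    then show "(a \<oplus> b) \<odot>\<^bsub>quotient_module M N\<^esub> X =
        a \<odot>\<^bsub>quotient_module M N\<^esub> X \<oplus>\<^bsub>quotient_module M N\<^esub> b \<odot>\<^bsub>quotient_module M N\<^esub> X"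
      using rc[of X] sc ac smult_l_distr
      by (auto simp del: quotient_module_simps(3,4))
  next
    fix a X Y assume "a \<in> carrier R" "X \<in> carrier (quotient_module M N)"
      "Y \<in> carrier (quotient_module M N)"
    then show "a \<odot>\<^bsub>quotient_module M N\<^esub> (X \<oplus>\<^bsub>quotient_module M N\<^esub> Y) =
        a \<odot>\<^bsub>quotient_module M N\<^esub> X \<oplus>\<^bsub>quotient_module M N\<^esub> a \<odot>\<^bsub>quotient_module M N\<^esub> Y"
      using rc[of X] rc[of Y] sc ac smult_r_distr
      by (auto simp del: quotient_module_simps(3,4))
  next
    fix a b X assume "a \<in> carrier R" "b \<in> carrier R" "X \<in> carrier (quotient_module M N)"
    then show "(a \<otimes> b) \<odot>\<^bsub>quotient_module M N\<^esub> X =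
        a \<odot>\<^bsub>quotient_module M N\<^esub> (b \<odot>\<^bsub>quotient_module M N\<^esub> X)"
      using rc[of X] sc smult_assoc1
      by (auto simp del: quotient_module_simps(3,4))
  next
    fix X assume "X \<in> carrier (quotient_module M N)"
    then show "\<one> \<odot>\<^bsub>quotient_module M N\<^esub> X = X"
      using rc[of X] sc[of \<one>] 
      by (auto simp del: quotient_module_simps(3,4))
  qed
qed

end

lemma tensor_relators_subset:
  assumes "module K M" "module K N"
  shows "tensor_relators K M N \<subseteq> carrier (free_module K (carrier M \<times> carrier N))"
proof -
  interpret M: module K M by fact
  interpret N: module K N by fact
  interpret F: module K "free_module K (carrier M \<times> carrier N)"
    by (rule free_module_module) (rule M.is_cring)
  have g: "free_gen K (x,y) \<in> carrier (free_module K (carrier M \<times> carrier N))"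
    if "x \<in> carrier M" "y \<in> carrier N" for x y
    using that by (intro free_gen_carrier M.is_cring) auto
  show ?thesis unfolding tensor_relators_def Let_def
    using g by (auto simp del: free_module_simps intro!: F.M.minus_closed F.M.a_closed F.smult_closed)
qed

lemma tensor_kernel_submodule:
  assumes "module K M" "module K N"
  shows "submodule (tensor_kernel K M N) K (free_module K (carrier M \<times> carrier N))"
    (is "submodule _ K ?F")
proof -
  interpret M: module K M by fact
  interpret F: module K ?F
    by (rule free_module_module) (rule M.is_cring)
  have ex: "carrier ?F \<in> {H. submodule H K ?F \<and> tensor_relators K M N \<subseteq> H}"
    using F.carrier_is_submodule tensor_relators_subset[OF assms] by auto
  show ?thesis unfolding tensor_kernel_def
  proof (rule F.submoduleI)
    show "\<Inter> {H. submodule H K ?F \<and> tensor_relators K M N \<subseteq> H} \<subseteq> carrier ?F" using ex by blast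
    show "\<zero>\<^bsub>?F\<^esub> \<in> \<Inter> {H. submodule H K ?F \<and> tensor_relators K M N \<subseteq> H}"
    proof (rule InterI)
      fix H assume "H \<in> {H. submodule H K ?F \<and> tensor_relators K M N \<subseteq> H}"
      then have "subgroup H (add_monoid ?F)" by (auto simp: submodule_def)
      from subgroup.one_closed[OF this] show "\<zero>\<^bsub>?F\<^esub> \<in> H" by simp
    qed
  qed (auto dest: F.submoduleE simp del: free_module_simps)
qed

lemma tensor_relators_kernel: "tensor_relators K M N \<subseteq> tensor_kernel K M N"
  unfolding tensor_kernel_def by blast

lemma tensor_module:
  assumes "module K M" "module K N" shows "module K (tensor K M N)"
proof -
  interpret M: module K M by fact
  interpret F: module K "free_module K (carrier M \<times> carrier N)"
    by (rule free_module_module) (rule M.is_cring)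
  show ?thesis unfolding tensor_def
    by (rule F.quotient_module_module) (rule tensor_kernel_submodule[OF assms])
qed

lemma free_extend_superset:
  assumes W: "module K W" and b: "b \<in> X \<rightarrow> carrier W" and \<phi>: "\<phi> \<in> carrier (free_module K X)"
    and S: "finite S" "{x. \<phi> x \<noteq> \<zero>\<^bsub>K\<^esub>} \<subseteq> S" "S \<subseteq> X"
  shows "free_extend K W b \<phi> = (\<Oplus>\<^bsub>W\<^esub>x \<in> S. \<phi> x \<odot>\<^bsub>W\<^esub> b x)"
proof -
  interpret W: module K W by fact
  show ?thesis unfolding free_extend_def
    using S b \<phi> W.smult_l_null
    by (intro W.M.add.finprod_mono_neutral_cong_left) 
      (auto simp: free_module_carrier_iff Pi_iff subset_iff)
qed

lemma free_extend_linear: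
  assumes W: "module K W" and b: "b \<in> X \<rightarrow> carrier W"
  shows "free_extend K W b \<in> linear_maps K (free_module K X) W"
proof -
  interpret W: module K W by fact
  interpret F: module K "free_module K X" by (rule free_module_module) (rule W.is_cring)
  let ?supp = "\<lambda>\<phi>. {x. \<phi> x \<noteq> \<zero>\<^bsub>K\<^esub>}"
  have f: "(\<lambda>x. \<phi> x \<odot>\<^bsub>W\<^esub> b x) \<in> S \<rightarrow> carrier W"
    if "\<phi> \<in> carrier (free_module K X)" "S \<subseteq> X" for \<phi> S
    using that b by (auto simp: free_module_carrier_iff Pi_iff)
  have 1: "free_extend K W b \<phi> \<in> carrier W" if "\<phi> \<in> carrier (free_module K X)" for \<phi>
    unfolding free_extend_def using that f[OF that, of "?supp \<phi>"]
    by (intro W.M.finsum_closed) (auto simp: free_module_carrier_iff)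
  have 2: "free_extend K W b (\<phi> \<oplus>\<^bsub>free_module K X\<^esub> \<psi>) = free_extend K W b \<phi> \<oplus>\<^bsub>W\<^esub> free_extend K W b \<psi>"
    if p: "\<phi> \<in> carrier (free_module K X)" and q: "\<psi> \<in> carrier (free_module K X)" for \<phi> \<psi>
  proof -
    let ?S = "?supp \<phi> \<union> ?supp \<psi>"
    have S: "finite ?S" "?S \<subseteq> X" using p q by (auto simp: free_module_carrier_iff)
    have "free_extend K W b (\<phi> \<oplus>\<^bsub>free_module K X\<^esub> \<psi>) =
        (\<Oplus>\<^bsub>W\<^esub>x \<in> ?S. (\<phi> \<oplus>\<^bsub>free_module K X\<^esub> \<psi>) x \<odot>\<^bsub>W\<^esub> b x)"
      by (rule free_extend_superset[OF W b F.M.a_closed[OF p q] S(1) _ S(2)]) (auto simp: p q)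
    also have "\<dots> = (\<Oplus>\<^bsub>W\<^esub>x \<in> ?S. \<phi> x \<odot>\<^bsub>W\<^esub> b x \<oplus>\<^bsub>W\<^esub> \<psi> x \<odot>\<^bsub>W\<^esub> b x)"
      using p q b S f[OF p S(2)] f[OF q S(2)]
      by (intro W.M.finsum_cong') (auto simp: Pi_iff free_module_carrier_iff subset_iff W.smult_l_distr)
    also have "\<dots> = free_extend K W b \<phi> \<oplus>\<^bsub>W\<^esub> free_extend K W b \<psi>"
      using W.M.finsum_addf[OF f[OF p S(2)] f[OF q S(2)]]
        free_extend_superset[OF W b p S(1) _ S(2)] free_extend_superset[OF W b q S(1) _ S(2)] by simp
    finally show ?thesis .
  qed
  have 3: "free_extend K W b (a \<odot>\<^bsub>free_module K X\<^esub> \<phi>) = a \<odot>\<^bsub>W\<^esub> free_extend K W b \<phi>"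
    if a: "a \<in> carrier K" and p: "\<phi> \<in> carrier (free_module K X)" for a \<phi>
  proof -
    let ?S = "?supp \<phi>"
    have S: "finite ?S" "?S \<subseteq> X" using p by (auto simp: free_module_carrier_iff)
    have "free_extend K W b (a \<odot>\<^bsub>free_module K X\<^esub> \<phi>) =
        (\<Oplus>\<^bsub>W\<^esub>x \<in> ?S. (a \<odot>\<^bsub>free_module K X\<^esub> \<phi>) x \<odot>\<^bsub>W\<^esub> b x)"
      by (rule free_extend_superset[OF W b F.smult_closed[OF a p] S(1) _ S(2)]) (auto simp: a p)
    also have "\<dots> = (\<Oplus>\<^bsub>W\<^esub>x \<in> ?S. a \<odot>\<^bsub>W\<^esub> (\<phi> x \<odot>\<^bsub>W\<^esub> b x))"
      using p a b S f[OF p S(2)]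
      by (intro W.M.finsum_cong') (auto simp: Pi_iff free_module_carrier_iff subset_iff W.smult_assoc1)
    also have "\<dots> = a \<odot>\<^bsub>W\<^esub> free_extend K W b \<phi>"
      unfolding free_extend_def using W.finsum_smult_ldistr[OF S(1) a f[OF p S(2)]] by simp
    finally show ?thesis .
  qed
  show ?thesis unfolding linear_maps_def using 1 2 3 by (auto simp del: free_module_simps)
qed

lemma free_extend_gen:
  assumes W: "module K W" and b: "b \<in> X \<rightarrow> carrier W" and x: "x \<in> X"
  shows "free_extend K W b (free_gen K x) = b x"
proof -
  interpret W: module K W by fact
  have "free_extend K W b (free_gen K x) = (\<Oplus>\<^bsub>W\<^esub>y \<in> {x}. free_gen K x y \<odot>\<^bsub>W\<^esub> b y)"
    using x by (intro free_extend_superset[OF W b free_gen_carrier[OF W.is_cring x]])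
      (auto simp: free_gen_def)
  also have "\<dots> = b x" using x b by (simp add: free_gen_def Pi_iff)
  finally show ?thesis .
qed

lemma linear_map_minus:
  assumes M: "module K M" and W: "module K W" and h: "h \<in> linear_maps K M W"
    and x: "x \<in> carrier M" and y: "y \<in> carrier M"
  shows "h (x \<ominus>\<^bsub>M\<^esub> y) = h x \<ominus>\<^bsub>W\<^esub> h y" 
proof -
  interpret M: module K M by fact
  interpret W: module K W by fact
  have e: "x \<ominus>\<^bsub>M\<^esub> y = x \<oplus>\<^bsub>M\<^esub> (\<ominus>\<^bsub>K\<^esub> \<one>\<^bsub>K\<^esub>) \<odot>\<^bsub>M\<^esub> y"
    using x y by (simp add: a_minus_def M.smult_l_minus)
  have hh: "h x \<in> carrier W" "h y \<in> carrier W" using h x y by (auto simp: linear_maps_def)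
  have "h (x \<ominus>\<^bsub>M\<^esub> y) = h x \<oplus>\<^bsub>W\<^esub> (\<ominus>\<^bsub>K\<^esub> \<one>\<^bsub>K\<^esub>) \<odot>\<^bsub>W\<^esub> h y"
    unfolding e using h x y by (simp add: linear_maps_def)
  then show ?thesis using hh by (simp add: a_minus_def W.smult_l_minus)
qed

lemma linear_map_kernel_submodule:
  assumes M: "module K M" and W: "module K W" and h: "h \<in> linear_maps K M W"
  shows "submodule {x \<in> carrier M. h x = \<zero>\<^bsub>W\<^esub>} K M"
proof -
  interpret M: module K M by fact
  interpret W: module K W by fact
  have z: "h \<zero>\<^bsub>M\<^esub> = \<zero>\<^bsub>W\<^esub>"
  proof -
    have "h (\<zero>\<^bsub>M\<^esub> \<ominus>\<^bsub>M\<^esub> \<zero>\<^bsub>M\<^esub>) = h \<zero>\<^bsub>M\<^esub> \<ominus>\<^bsub>W\<^esub> h \<zero>\<^bsub>M\<^esub>"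
      by (rule linear_map_minus[OF assms]) auto
    moreover have "h \<zero>\<^bsub>M\<^esub> \<in> carrier W" using h by (auto simp: linear_maps_def)
    ultimately show ?thesis by (simp add: a_minus_def M.M.r_neg W.M.r_neg)
  qed
  show ?thesis
  proof (rule M.submoduleI)
    fix a assume "a \<in> {x \<in> carrier M. h x = \<zero>\<^bsub>W\<^esub>}"
    then show "\<ominus>\<^bsub>M\<^esub> a \<in> {x \<in> carrier M. h x = \<zero>\<^bsub>W\<^esub>}"
      using linear_map_minus[OF assms, of "\<zero>\<^bsub>M\<^esub>" a] z by (simp add: a_minus_def)
  qed (use h z in \<open>auto simp: linear_maps_def\<close>)
qed

lemma free_extend_tensor_kernel:
  assumes M: "module K M" and N: "module K N" and W: "module K W"
    and \<beta>: "bilinear_map K M N W \<beta>"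
    and \<phi>: "\<phi> \<in> tensor_kernel K M N"
  shows "free_extend K W (case_prod \<beta>) \<phi> = \<zero>\<^bsub>W\<^esub>"
proof -
  let ?F = "free_module K (carrier M \<times> carrier N)"
  interpret M: module K M by fact
  interpret N: module K N by fact
  interpret W: module K W by fact
  have F: "module K ?F" by (rule free_module_module) (rule M.is_cring)
  interpret F: module K ?F by fact
  have b: "case_prod \<beta> \<in> carrier M \<times> carrier N \<rightarrow> carrier W"
    using \<beta> by (auto simp: bilinear_map_def linear_maps_def)
  let ?h = "free_extend K W (case_prod \<beta>)"
  have h: "?h \<in> linear_maps K ?F W" by (rule free_extend_linear[OF W b])
  have g: "free_gen K (x,y) \<in> carrier ?F" if "x \<in> carrier M" "y \<in> carrier N" for x y
    using that by (intro free_gen_carrier M.is_cring) auto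
  have hg: "?h (free_gen K (x,y)) = \<beta> x y" if "x \<in> carrier M" "y \<in> carrier N" for x y
    using free_extend_gen[OF W b, of "(x,y)"] that by auto
  note hm = linear_map_minus[OF F W h]
  have ha: "?h (u \<oplus>\<^bsub>?F\<^esub> v) = ?h u \<oplus>\<^bsub>W\<^esub> ?h v" if "u \<in> carrier ?F" "v \<in> carrier ?F" for u v
    using h that unfolding linear_maps_def by blast
  have hs: "?h (a \<odot>\<^bsub>?F\<^esub> u) = a \<odot>\<^bsub>W\<^esub> ?h u" if "a \<in> carrier K" "u \<in> carrier ?F" for a u
    using h that unfolding linear_maps_def by blast
  have bc: "\<beta> x y \<in> carrier W" if "x \<in> carrier M" "y \<in> carrier N" for x y
    using funcset_mem[OF b, of "(x, y)"] that by simp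
  have bl: "\<beta> (x \<oplus>\<^bsub>M\<^esub> x') y = \<beta> x y \<oplus>\<^bsub>W\<^esub> \<beta> x' y" "\<beta> (a \<odot>\<^bsub>M\<^esub> x) y = a \<odot>\<^bsub>W\<^esub> \<beta> x y"
    "\<beta> x (y \<oplus>\<^bsub>N\<^esub> y') = \<beta> x y \<oplus>\<^bsub>W\<^esub> \<beta> x y'" "\<beta> x (a \<odot>\<^bsub>N\<^esub> y) = a \<odot>\<^bsub>W\<^esub> \<beta> x y"
    if "a \<in> carrier K" "x \<in> carrier M" "x' \<in> carrier M" "y \<in> carrier N" "y' \<in> carrier N" for a x x' y y'
    using \<beta> that by (auto simp: bilinear_map_def linear_maps_def)
  have mm: "w \<ominus>\<^bsub>W\<^esub> w = \<zero>\<^bsub>W\<^esub>" if "w \<in> carrier W" for w using that by (simp add: a_minus_def W.M.r_neg)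
  let ?H = "{u \<in> carrier ?F. ?h u = \<zero>\<^bsub>W\<^esub>}"
  have "?h u = \<zero>\<^bsub>W\<^esub>" if "u \<in> tensor_relators K M N" for u
    using that unfolding tensor_relators_def Let_def
  proof (elim UnE CollectE exE conjE)
    fix x x' y
    assume "u = free_gen K (x \<oplus>\<^bsub>M\<^esub> x', y) \<ominus>\<^bsub>?F\<^esub> (free_gen K (x, y) \<oplus>\<^bsub>?F\<^esub> free_gen K (x', y))"
      "x \<in> carrier M" "x' \<in> carrier M" "y \<in> carrier N"
    then show ?thesis using g hg bc bl[of "\<zero>\<^bsub>K\<^esub>" x x' y y]
      by (simp add: hm ha mm F.M.a_closed del: free_module_simps)
  next
    fix x y y'
    assume "u = free_gen K (x, y \<oplus>\<^bsub>N\<^esub> y') \<ominus>\<^bsub>?F\<^esub> (free_gen K (x, y) \<oplus>\<^bsub>?F\<^esub> free_gen K (x, y'))"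
      "x \<in> carrier M" "y \<in> carrier N" "y' \<in> carrier N"
    then show ?thesis using g hg bc bl[of "\<zero>\<^bsub>K\<^esub>" x x y y']
      by (simp add: hm ha mm F.M.a_closed del: free_module_simps)
  next
    fix a x y
    assume "u = free_gen K (a \<odot>\<^bsub>M\<^esub> x, y) \<ominus>\<^bsub>?F\<^esub> (a \<odot>\<^bsub>?F\<^esub> free_gen K (x, y))"
      "a \<in> carrier K" "x \<in> carrier M" "y \<in> carrier N"
    then show ?thesis using g hg bc bl[of a x x y y]
      by (simp add: hm hs mm F.smult_closed del: free_module_simps)
  next
    fix a x y
    assume "u = free_gen K (x, a \<odot>\<^bsub>N\<^esub> y) \<ominus>\<^bsub>?F\<^esub> (a \<odot>\<^bsub>?F\<^esub> free_gen K (x, y))"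
      "a \<in> carrier K" "x \<in> carrier M" "y \<in> carrier N"
    then show ?thesis using g hg bc bl[of a x x y y]
      by (simp add: hm hs mm F.smult_closed del: free_module_simps)
  qed
  then have "tensor_relators K M N \<subseteq> ?H"
    using tensor_relators_subset[OF M N] by blast
  moreover have "submodule ?H K ?F" by (rule linear_map_kernel_submodule[OF F W h])
  ultimately have "tensor_kernel K M N \<subseteq> ?H" unfolding tensor_kernel_def by blast
  with \<phi> show ?thesis by blast
qed

lemma tensor_lift_coset:
  assumes M: "module K M" and N: "module K N" and W: "module K W"
    and \<beta>: "bilinear_map K M N W \<beta>"
    and \<phi>: "\<phi> \<in> carrier (free_module K (carrier M \<times> carrier N))"
  shows "tensor_lift K W \<beta> (tensor_kernel K M N +>\<^bsub>free_module K (carrier M \<times> carrier N)\<^esub> \<phi>) =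
    free_extend K W (case_prod \<beta>) \<phi>"
proof -
  let ?F = "free_module K (carrier M \<times> carrier N)"
  interpret W: module K W by fact
  interpret F: module K ?F by (rule free_module_module) (rule W.is_cring)
  note sub = tensor_kernel_submodule[OF M N]
  interpret T: abelian_subgroup "tensor_kernel K M N" ?F
    by (rule F.submodule_abelian_subgroup[OF sub])
  have b: "case_prod \<beta> \<in> carrier M \<times> carrier N \<rightarrow> carrier W"
    using \<beta> by (auto simp: bilinear_map_def linear_maps_def)
  let ?h = "free_extend K W (case_prod \<beta>)"
  have h: "?h \<in> linear_maps K ?F W" by (rule free_extend_linear[OF W b])
  have "?h \<psi> = ?h \<phi>" if "\<psi> \<in> tensor_kernel K M N +>\<^bsub>?F\<^esub> \<phi>" for \<psi>
  proof -
    from that obtain n where n: "n \<in> tensor_kernel K M N" "\<psi> = n \<oplus>\<^bsub>?F\<^esub> \<phi>"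
      by (auto simp: a_r_coset_def')
    then have "n \<in> carrier ?F" using T.a_subset by blast
    then have "?h \<psi> = ?h n \<oplus>\<^bsub>W\<^esub> ?h \<phi>" using h \<phi> n(2) unfolding linear_maps_def by blast
    moreover have "?h \<phi> \<in> carrier W" using h \<phi> by (auto simp: linear_maps_def)
    ultimately show ?thesis using free_extend_tensor_kernel[OF M N W \<beta> n(1)] by simp
  qed
  moreover have "\<phi> \<in> tensor_kernel K M N +>\<^bsub>?F\<^esub> \<phi>" using T.a_rcos_self \<phi> by blast
  ultimately have "?h ` (tensor_kernel K M N +>\<^bsub>?F\<^esub> \<phi>) = {?h \<phi>}" by blast
  then show ?thesis unfolding tensor_lift_def by simp
qed

lemma tensor_lift_pure:
  assumes M: "module K M" and N: "module K N" and W: "module K W"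
    and \<beta>: "bilinear_map K M N W \<beta>"
    and x: "x \<in> carrier M" and y: "y \<in> carrier N"
  shows "tensor_lift K W \<beta> (pure_tensor K M N x y) = \<beta> x y"
proof -
  interpret W: module K W by fact
  have b: "case_prod \<beta> \<in> carrier M \<times> carrier N \<rightarrow> carrier W"
    using \<beta> by (auto simp: bilinear_map_def linear_maps_def)
  have g: "free_gen K (x,y) \<in> carrier (free_module K (carrier M \<times> carrier N))"
    using x y by (intro free_gen_carrier W.is_cring) auto
  show ?thesis unfolding pure_tensor_def tensor_lift_coset[OF M N W \<beta> g]
    using free_extend_gen[OF W b, of "(x,y)"] x y by simp
qed

lemma tensor_carrier:
  "carrier (tensor K M N) = (\<lambda>\<phi>. tensor_kernel K M N +>\<^bsub>free_module K (carrier M \<times> carrier N)\<^esub> \<phi>) `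
    carrier (free_module K (carrier M \<times> carrier N))"
  by (auto simp: tensor_def A_RCOSETS_def')

lemma tensor_lift_linear:
  assumes M: "module K M" and N: "module K N" and W: "module K W"
    and \<beta>: "bilinear_map K M N W \<beta>"
  shows "tensor_lift K W \<beta> \<in> linear_maps K (tensor K M N) W"
proof -
  let ?F = "free_module K (carrier M \<times> carrier N)" and ?T = "tensor K M N"
  let ?q = "\<lambda>\<phi>. tensor_kernel K M N +>\<^bsub>?F\<^esub> \<phi>"
  interpret W: module K W by fact
  interpret F: module K ?F by (rule free_module_module) (rule W.is_cring)
  note sub = tensor_kernel_submodule[OF M N]
  have b: "case_prod \<beta> \<in> carrier M \<times> carrier N \<rightarrow> carrier W"
    using \<beta> by (auto simp: bilinear_map_def linear_maps_def)
  let ?h = "free_extend K W (case_prod \<beta>)"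
  have h: "?h \<in> linear_maps K ?F W" by (rule free_extend_linear[OF W b])
  note q = tensor_lift_coset[OF M N W \<beta>]
  have 1: "tensor_lift K W \<beta> (?q u \<oplus>\<^bsub>?T\<^esub> ?q v) =
      tensor_lift K W \<beta> (?q u) \<oplus>\<^bsub>W\<^esub> tensor_lift K W \<beta> (?q v)"
    if u: "u \<in> carrier ?F" and v: "v \<in> carrier ?F" for u v
    using F.quotient_add_coset[OF sub u v] q[OF u] q[OF v] q[OF F.M.a_closed[OF u v]] h u v
    unfolding tensor_def linear_maps_def by (simp del: free_module_simps quotient_module_simps)
  have 2: "tensor_lift K W \<beta> (a \<odot>\<^bsub>?T\<^esub> ?q u) = a \<odot>\<^bsub>W\<^esub> tensor_lift K W \<beta> (?q u)"
    if a: "a \<in> carrier K" and u: "u \<in> carrier ?F" for a u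
    using F.quotient_smult_coset[OF sub a u] q[OF u] q[OF F.smult_closed[OF a u]] h a u
    unfolding tensor_def linear_maps_def by (simp del: free_module_simps quotient_module_simps)
  have 3: "tensor_lift K W \<beta> (?q u) \<in> carrier W" if u: "u \<in> carrier ?F" for u
    using q[OF u] h u by (auto simp: linear_maps_def)
  show ?thesis unfolding linear_maps_def tensor_carrier using 1 2 3 by blast
qed

lemma pure_tensor_bilinear:
  assumes M: "module K M" and N: "module K N"
  shows "bilinear_map K M N (tensor K M N) (pure_tensor K M N)"
proof -
  let ?F = "free_module K (carrier M \<times> carrier N)" and ?T = "tensor K M N"
  let ?q = "\<lambda>\<phi>. tensor_kernel K M N +>\<^bsub>?F\<^esub> \<phi>"
  interpret M: module K M by fact
  interpret N: module K N by fact
  interpret F: module K ?F by (rule free_module_module) (rule M.is_cring)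
  note sub = tensor_kernel_submodule[OF M N]
  interpret T: abelian_subgroup "tensor_kernel K M N" ?F
    by (rule F.submodule_abelian_subgroup[OF sub])
  have g: "free_gen K (x,y) \<in> carrier ?F" if "x \<in> carrier M" "y \<in> carrier N" for x y
    using that by (intro free_gen_carrier M.is_cring) auto
  have eq: "?q u = ?q v" if "u \<ominus>\<^bsub>?F\<^esub> v \<in> tensor_relators K M N" "u \<in> carrier ?F" "v \<in> carrier ?F" for u v
  proof -
    have "u \<ominus>\<^bsub>?F\<^esub> v \<in> tensor_kernel K M N" using that(1) tensor_relators_kernel by blast
    moreover have "u = (u \<ominus>\<^bsub>?F\<^esub> v) \<oplus>\<^bsub>?F\<^esub> v"
      using that(2,3) by (simp add: a_minus_def F.M.a_assoc F.M.l_neg del: free_module_simps)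
    ultimately have "u \<in> ?q v" by (auto simp: a_r_coset_def' simp del: free_module_simps)
    then show ?thesis using T.a_repr_independence' that by metis
  qed
  have add: "?q (u \<oplus>\<^bsub>?F\<^esub> v) = ?q u \<oplus>\<^bsub>?T\<^esub> ?q v" if "u \<in> carrier ?F" "v \<in> carrier ?F" for u v
    using F.quotient_add_coset[OF sub that] by (simp add: tensor_def del: free_module_simps quotient_module_simps)
  have sm: "?q (a \<odot>\<^bsub>?F\<^esub> u) = a \<odot>\<^bsub>?T\<^esub> ?q u" if "a \<in> carrier K" "u \<in> carrier ?F" for a u
    using F.quotient_smult_coset[OF sub that] by (simp add: tensor_def del: free_module_simps quotient_module_simps)
  have c: "pure_tensor K M N x y \<in> carrier ?T" if "x \<in> carrier M" "y \<in> carrier N" for x y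
    using g[OF that] by (auto simp: pure_tensor_def tensor_carrier)
  have r1: "pure_tensor K M N (x \<oplus>\<^bsub>M\<^esub> x') y = pure_tensor K M N x y \<oplus>\<^bsub>?T\<^esub> pure_tensor K M N x' y"
    if xx: "x \<in> carrier M" "x' \<in> carrier M" "y \<in> carrier N" for x x' y
  proof -
    have "free_gen K (x \<oplus>\<^bsub>M\<^esub> x', y) \<ominus>\<^bsub>?F\<^esub> (free_gen K (x, y) \<oplus>\<^bsub>?F\<^esub> free_gen K (x', y))
        \<in> tensor_relators K M N" unfolding tensor_relators_def Let_def using xx by blast
    from eq[OF this] show ?thesis unfolding pure_tensor_def using xx g add F.M.a_closed
      by (metis M.M.a_closed)
  qed
  have r2: "pure_tensor K M N x (y \<oplus>\<^bsub>N\<^esub> y') = pure_tensor K M N x y \<oplus>\<^bsub>?T\<^esub> pure_tensor K M N x y'"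
    if xx: "x \<in> carrier M" "y \<in> carrier N" "y' \<in> carrier N" for x y y'
  proof -
    have "free_gen K (x, y \<oplus>\<^bsub>N\<^esub> y') \<ominus>\<^bsub>?F\<^esub> (free_gen K (x, y) \<oplus>\<^bsub>?F\<^esub> free_gen K (x, y'))
        \<in> tensor_relators K M N" unfolding tensor_relators_def Let_def using xx by blast
    from eq[OF this] show ?thesis unfolding pure_tensor_def using xx g add F.M.a_closed
      by (metis N.M.a_closed)
  qed
  have r3: "pure_tensor K M N (a \<odot>\<^bsub>M\<^esub> x) y = a \<odot>\<^bsub>?T\<^esub> pure_tensor K M N x y"
    if xx: "a \<in> carrier K" "x \<in> carrier M" "y \<in> carrier N" for a x y
  proof -
    have "free_gen K (a \<odot>\<^bsub>M\<^esub> x, y) \<ominus>\<^bsub>?F\<^esub> (a \<odot>\<^bsub>?F\<^esub> free_gen K (x, y))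
        \<in> tensor_relators K M N" unfolding tensor_relators_def Let_def using xx by blast
    from eq[OF this] show ?thesis unfolding pure_tensor_def using xx g sm F.smult_closed
      by (metis M.smult_closed)
  qed
  have r4: "pure_tensor K M N x (a \<odot>\<^bsub>N\<^esub> y) = a \<odot>\<^bsub>?T\<^esub> pure_tensor K M N x y"
    if xx: "a \<in> carrier K" "x \<in> carrier M" "y \<in> carrier N" for a x y
  proof -
    have "free_gen K (x, a \<odot>\<^bsub>N\<^esub> y) \<ominus>\<^bsub>?F\<^esub> (a \<odot>\<^bsub>?F\<^esub> free_gen K (x, y))
        \<in> tensor_relators K M N" unfolding tensor_relators_def Let_def using xx by blast
    from eq[OF this] show ?thesis unfolding pure_tensor_def using xx g sm F.smult_closed
      by (metis N.smult_closed)
  qed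
  show ?thesis unfolding bilinear_map_def linear_maps_def
    using c r1 r2 r3 r4 by auto
qed

lemma free_module_induct:
  fixes K :: "('k, 'r) ring_scheme" and X :: "'x set"
  assumes "cring K" "submodule H K (free_module K X)" "\<And>x. x \<in> X \<Longrightarrow> free_gen K x \<in> H"
    "\<phi> \<in> carrier (free_module K X)"
  shows "\<phi> \<in> H"
proof -
  interpret K: cring K by fact
  interpret F: module K "free_module K X" by (rule free_module_module) fact
  have "finite S \<Longrightarrow> \<forall>\<phi> \<in> carrier (free_module K X). {x. \<phi> x \<noteq> \<zero>\<^bsub>K\<^esub>} \<subseteq> S \<longrightarrow> \<phi> \<in> H" for S
  proof (induction S rule: finite_induct)
    case empty
    have "(\<lambda>x. \<zero>\<^bsub>K\<^esub>) \<in> H" 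
      using subgroup.one_closed[of H "add_monoid (free_module K X)"] assms(2) by (simp add: submodule_def)
    moreover have "\<phi> = (\<lambda>x. \<zero>\<^bsub>K\<^esub>)" if "{x. \<phi> x \<noteq> \<zero>\<^bsub>K\<^esub>} \<subseteq> {}" for \<phi> :: "'x \<Rightarrow> 'k"
      using that by auto
    ultimately show ?case by metis
  next
    case (insert s S)
    show ?case
    proof (intro ballI impI)
      fix \<phi> assume p: "\<phi> \<in> carrier (free_module K X)" and s: "{x. \<phi> x \<noteq> \<zero>\<^bsub>K\<^esub>} \<subseteq> insert s S"
      show "\<phi> \<in> H"
      proof (cases "\<phi> s = \<zero>\<^bsub>K\<^esub>")
        case True then show ?thesis using insert.IH p s by blast
      next
        case False
        then have sX: "s \<in> X" and c: "\<And>x. \<phi> x \<in> carrier K" using p by (auto simp: free_module_carrier_iff)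
        let ?\<psi> = "\<phi>(s := \<zero>\<^bsub>K\<^esub>)"
        have "{x. ?\<psi> x \<noteq> \<zero>\<^bsub>K\<^esub>} \<subseteq> {x. \<phi> x \<noteq> \<zero>\<^bsub>K\<^esub>}" by auto
        then have "?\<psi> \<in> carrier (free_module K X)"
          using p by (auto simp: free_module_carrier_iff intro: finite_subset)
        moreover have "{x. ?\<psi> x \<noteq> \<zero>\<^bsub>K\<^esub>} \<subseteq> S" using s by auto
        ultimately have "?\<psi> \<in> H" using insert.IH by blast
        moreover have "\<phi> s \<odot>\<^bsub>free_module K X\<^esub> free_gen K s \<in> H"
          using F.submoduleE(4)[OF assms(2) c assms(3)[OF sX]] .
        ultimately have "?\<psi> \<oplus>\<^bsub>free_module K X\<^esub> \<phi> s \<odot>\<^bsub>free_module K X\<^esub> free_gen K s \<in> H"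
          by (rule F.submoduleE(5)[OF assms(2)])
        also have "?\<psi> \<oplus>\<^bsub>free_module K X\<^esub> \<phi> s \<odot>\<^bsub>free_module K X\<^esub> free_gen K s = \<phi>"
          using c by (auto simp: free_gen_def)
        finally show ?thesis .
      qed
    qed
  qed
  moreover have "finite {x. \<phi> x \<noteq> \<zero>\<^bsub>K\<^esub>}" using assms(4) by (simp add: free_module_carrier_iff)
  ultimately show ?thesis using assms(4) by blast
qed

lemma tensor_linear_eqI:
  assumes M: "module K M" and N: "module K N" and W: "module K W"
    and g: "g \<in> linear_maps K (tensor K M N) W" and h: "h \<in> linear_maps K (tensor K M N) W"
    and eq: "\<And>x y. \<lbrakk>x \<in> carrier M; y \<in> carrier N\<rbrakk> \<Longrightarrow>
      g (pure_tensor K M N x y) = h (pure_tensor K M N x y)"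
    and t: "t \<in> carrier (tensor K M N)"
  shows "g t = h t"
proof -
  let ?F = "free_module K (carrier M \<times> carrier N)" and ?T = "tensor K M N"
  let ?q = "\<lambda>\<phi>. tensor_kernel K M N +>\<^bsub>?F\<^esub> \<phi>"
  interpret W: module K W by fact
  have F: "module K ?F" by (rule free_module_module) (rule W.is_cring)
  interpret F: module K ?F by fact
  note sub = tensor_kernel_submodule[OF M N]
  have k: "(\<lambda>u. k (?q u)) \<in> linear_maps K ?F W" if k: "k \<in> linear_maps K ?T W" for k
  proof -
    have "?q u \<in> carrier ?T" if "u \<in> carrier ?F" for u using that by (auto simp: tensor_carrier)
    moreover have "?q (u \<oplus>\<^bsub>?F\<^esub> v) = ?q u \<oplus>\<^bsub>?T\<^esub> ?q v" if "u \<in> carrier ?F" "v \<in> carrier ?F" for u v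
      using F.quotient_add_coset[OF sub that] by (simp add: tensor_def del: free_module_simps quotient_module_simps)
    moreover have "?q (a \<odot>\<^bsub>?F\<^esub> u) = a \<odot>\<^bsub>?T\<^esub> ?q u" if "a \<in> carrier K" "u \<in> carrier ?F" for a u
      using F.quotient_smult_coset[OF sub that] by (simp add: tensor_def del: free_module_simps quotient_module_simps)
    ultimately show ?thesis using k unfolding linear_maps_def
      by (simp add: Pi_iff del: free_module_simps)
  qed
  have d: "(\<lambda>u. g (?q u) \<ominus>\<^bsub>W\<^esub> h (?q u)) \<in> linear_maps K ?F W"
  proof -
    have c: "g (?q u) \<in> carrier W" "h (?q u) \<in> carrier W" if "u \<in> carrier ?F" for u
      using k[OF g] k[OF h] that by (auto simp: linear_maps_def)
    show ?thesis using k[OF g] k[OF h] c unfolding linear_maps_def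
      by (auto simp: a_minus_def W.M.minus_add W.M.a_ac W.smult_r_distr W.smult_r_minus
          simp del: free_module_simps)
  qed
  let ?H = "{u \<in> carrier ?F. g (?q u) \<ominus>\<^bsub>W\<^esub> h (?q u) = \<zero>\<^bsub>W\<^esub>}"
  have H: "submodule ?H K ?F" by (rule linear_map_kernel_submodule[OF F W d])
  have c: "g (?q u) \<in> carrier W" "h (?q u) \<in> carrier W" if "u \<in> carrier ?F" for u
    using k[OF g] k[OF h] that by (auto simp: linear_maps_def)
  have "free_gen K p \<in> ?H" if "p \<in> carrier M \<times> carrier N" for p
    using that eq free_gen_carrier[OF W.is_cring that] c(2)[OF free_gen_carrier[OF W.is_cring that]]
    by (auto simp: pure_tensor_def a_minus_def W.M.r_neg)
  then have "u \<in> ?H" if "u \<in> carrier ?F" for u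
    using free_module_induct[OF W.is_cring H _ that] by blast
  then have "g (?q u) = h (?q u)" if "u \<in> carrier ?F" for u
    using that c[OF that] W.M.minus_equality[of "g (?q u)" "\<ominus>\<^bsub>W\<^esub> h (?q u)"]
    by (simp add: a_minus_def)
  then show ?thesis using t by (auto simp: tensor_carrier)
qed

declare free_module_simps [simp del] quotient_module_simps [simp del]


section \<open>Tensor products of linear maps\<close>

text \<open>\<open>tensor_map K M' N' f g\<close> is \<open>f \<otimes> g\<close>, where \<open>M'\<close> and \<open>N'\<close> are the codomains.\<close>

definition tensor_map ::
    "('k, 'r) ring_scheme \<Rightarrow> ('k, 'a2, 'm) module_scheme \<Rightarrow> ('k, 'b2, 'n) module_scheme \<Rightarrow>
      ('a \<Rightarrow> 'a2) \<Rightarrow> ('b \<Rightarrow> 'b2) \<Rightarrow> ('a \<times> 'b \<Rightarrow> 'k) set \<Rightarrow> ('a2 \<times> 'b2 \<Rightarrow> 'k) set"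
  where "tensor_map K M' N' f g =
    tensor_lift K (tensor K M' N') (\<lambda>x y. pure_tensor K M' N' (f x) (g y))"

text \<open>The associativity isomorphism sending \<open>(x \<otimes> y) \<otimes> z\<close> to \<open>x \<otimes> (y \<otimes> z)\<close>.\<close>

definition tensor_assoc ::
    "('k, 'r) ring_scheme \<Rightarrow> ('k, 'a, 'm) module_scheme \<Rightarrow> ('k, 'b, 'n) module_scheme \<Rightarrow>
      ('k, 'c, 'o) module_scheme \<Rightarrow> (('a \<times> 'b \<Rightarrow> 'k) set \<times> 'c \<Rightarrow> 'k) set \<Rightarrow>
      ('a \<times> ('b \<times> 'c \<Rightarrow> 'k) set \<Rightarrow> 'k) set"
  where "tensor_assoc K L M N = (let W = tensor K L (tensor K M N) in
    tensor_lift K W (\<lambda>t z. tensor_lift K W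
      (\<lambda>x y. pure_tensor K L (tensor K M N) x (pure_tensor K M N y z)) t))"


section \<open>Rota-Baxter coalgebras\<close>

locale noncounitary_coalgebra = module K C
  for K :: "('k, 'r) ring_scheme" and C :: "('k, 'c, 'm) module_scheme" +
  fixes \<Delta> :: "'c \<Rightarrow> ('c \<times> 'c \<Rightarrow> 'k) set"
  assumes coproduct_linear: "\<Delta> \<in> linear_maps K C (tensor K C C)"
    and coassociative: "c \<in> carrier C \<Longrightarrow>
      tensor_assoc K C C C (tensor_map K (tensor K C C) C \<Delta> id (\<Delta> c)) =
      tensor_map K C (tensor K C C) id \<Delta> (\<Delta> c)"

text \<open>The counit axioms are equations in \<open>K \<otimes> C\<close> and \<open>C \<otimes> K\<close>; both spaces are identified with
  \<open>C\<close> through \<open>c \<mapsto> 1 \<otimes> c\<close> and \<open>c \<mapsto> c \<otimes> 1\<close>.\<close>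

locale counitary_coalgebra = noncounitary_coalgebra K C \<Delta>
  for K :: "('k, 'r) ring_scheme" and C :: "('k, 'c, 'm) module_scheme"
    and \<Delta> :: "'c \<Rightarrow> ('c \<times> 'c \<Rightarrow> 'k) set" +
  fixes \<epsilon> :: "'c \<Rightarrow> 'k"
  assumes counit_linear: "\<epsilon> \<in> linear_maps K C (ground_module K)"
    and counit_left: "c \<in> carrier C \<Longrightarrow>
      tensor_map K (ground_module K) C \<epsilon> id (\<Delta> c) = pure_tensor K (ground_module K) C \<one>\<^bsub>K\<^esub> c"
    and counit_right: "c \<in> carrier C \<Longrightarrow>
      tensor_map K C (ground_module K) id \<epsilon> (\<Delta> c) = pure_tensor K C (ground_module K) c \<one>\<^bsub>K\<^esub>"

locale noncounitary_rota_baxter_coalgebra = noncounitary_coalgebra K C \<Delta>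
  for K :: "('k, 'r) ring_scheme" and C :: "('k, 'c, 'm) module_scheme"
    and \<Delta> :: "'c \<Rightarrow> ('c \<times> 'c \<Rightarrow> 'k) set" +
  fixes P :: "'c \<Rightarrow> 'c" and weight :: 'k
  assumes weight_closed: "weight \<in> carrier K"
    and operator_linear: "P \<in> linear_maps K C C"
    and rota_baxter_coidentity: "c \<in> carrier C \<Longrightarrow>
      tensor_map K C C P P (\<Delta> c) =
      tensor_map K C C id P (\<Delta> (P c)) \<oplus>\<^bsub>tensor K C C\<^esub>
      tensor_map K C C P id (\<Delta> (P c)) \<oplus>\<^bsub>tensor K C C\<^esub>
      weight \<odot>\<^bsub>tensor K C C\<^esub> \<Delta> (P c)"

locale rota_baxter_coalgebra =
  counitary_coalgebra K C \<Delta> \<epsilon> + noncounitary_rota_baxter_coalgebra K C \<Delta> P weight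
  for K :: "('k, 'r) ring_scheme" and C :: "('k, 'c, 'm) module_scheme"
    and \<Delta> :: "'c \<Rightarrow> ('c \<times> 'c \<Rightarrow> 'k) set" and \<epsilon> :: "'c \<Rightarrow> 'k"
    and P :: "'c \<Rightarrow> 'c" and weight :: 'k


section \<open>Rota-Baxter algebras\<close>

text \<open>The library locale \<open>algebra\<close> is for commutative unital algebras.\<close>

locale nonunitary_algebra = module K A
  for K :: "('k, 'r) ring_scheme" and A :: "('k, 'a, 'm) module_scheme" +
  assumes mult_closed: "\<lbrakk>x \<in> carrier A; y \<in> carrier A\<rbrakk> \<Longrightarrow> x \<otimes>\<^bsub>A\<^esub> y \<in> carrier A"
    and mult_assoc: "\<lbrakk>x \<in> carrier A; y \<in> carrier A; z \<in> carrier A\<rbrakk> \<Longrightarrow>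
      (x \<otimes>\<^bsub>A\<^esub> y) \<otimes>\<^bsub>A\<^esub> z = x \<otimes>\<^bsub>A\<^esub> (y \<otimes>\<^bsub>A\<^esub> z)"
    and mult_l_distr: "\<lbrakk>x \<in> carrier A; y \<in> carrier A; z \<in> carrier A\<rbrakk> \<Longrightarrow>
      (x \<oplus>\<^bsub>A\<^esub> y) \<otimes>\<^bsub>A\<^esub> z = x \<otimes>\<^bsub>A\<^esub> z \<oplus>\<^bsub>A\<^esub> y \<otimes>\<^bsub>A\<^esub> z"
    and mult_r_distr: "\<lbrakk>x \<in> carrier A; y \<in> carrier A; z \<in> carrier A\<rbrakk> \<Longrightarrow>
      z \<otimes>\<^bsub>A\<^esub> (x \<oplus>\<^bsub>A\<^esub> y) = z \<otimes>\<^bsub>A\<^esub> x \<oplus>\<^bsub>A\<^esub> z \<otimes>\<^bsub>A\<^esub> y"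
    and smult_mult_left: "\<lbrakk>a \<in> carrier K; x \<in> carrier A; y \<in> carrier A\<rbrakk> \<Longrightarrow>
      (a \<odot>\<^bsub>A\<^esub> x) \<otimes>\<^bsub>A\<^esub> y = a \<odot>\<^bsub>A\<^esub> (x \<otimes>\<^bsub>A\<^esub> y)"
    and smult_mult_right: "\<lbrakk>a \<in> carrier K; x \<in> carrier A; y \<in> carrier A\<rbrakk> \<Longrightarrow>
      x \<otimes>\<^bsub>A\<^esub> (a \<odot>\<^bsub>A\<^esub> y) = a \<odot>\<^bsub>A\<^esub> (x \<otimes>\<^bsub>A\<^esub> y)"

locale nonunitary_rota_baxter_algebra = nonunitary_algebra K A
  for K :: "('k, 'r) ring_scheme" and A :: "('k, 'a, 'm) module_scheme" +
  fixes Q :: "'a \<Rightarrow> 'a" and weight :: 'k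
  assumes weight_closed: "weight \<in> carrier K"
    and operator_linear: "Q \<in> linear_maps K A A"
    and rota_baxter_identity: "\<lbrakk>x \<in> carrier A; y \<in> carrier A\<rbrakk> \<Longrightarrow>
      Q x \<otimes>\<^bsub>A\<^esub> Q y =
      Q (x \<otimes>\<^bsub>A\<^esub> Q y) \<oplus>\<^bsub>A\<^esub> Q (Q x \<otimes>\<^bsub>A\<^esub> y) \<oplus>\<^bsub>A\<^esub> weight \<odot>\<^bsub>A\<^esub> Q (x \<otimes>\<^bsub>A\<^esub> y)"

locale rota_baxter_algebra = nonunitary_rota_baxter_algebra K A Q weight + monoid A
  for K :: "('k, 'r) ring_scheme" and A :: "('k, 'a, 'm) module_scheme"
    and Q :: "'a \<Rightarrow> 'a" and weight :: 'k


section \<open>Linear duals\<close>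

text \<open>Linear forms are restricted to the carrier of \<open>C\<close>, so that a form is determined by its
  values there.\<close>

definition dual_module ::
    "('k, 'r) ring_scheme \<Rightarrow> ('k, 'c, 'm) module_scheme \<Rightarrow> ('k, 'c \<Rightarrow> 'k) module"
  where "dual_module K C = \<lparr>
    carrier = linear_maps K C (ground_module K) \<inter> extensional (carrier C),
    mult = undefined, one = undefined,
    zero = (\<lambda>c \<in> carrier C. \<zero>\<^bsub>K\<^esub>),
    add = (\<lambda>f g. \<lambda>c \<in> carrier C. f c \<oplus>\<^bsub>K\<^esub> g c),
    smult = (\<lambda>a f. \<lambda>c \<in> carrier C. a \<otimes>\<^bsub>K\<^esub> f c)\<rparr>"

text \<open>If \<open>\<Delta> c\<close> is a sum of pure tensors \<open>c\<^sub>1 \<otimes> c\<^sub>2\<close>, then the convolution product of \<open>f\<close> and \<open>g\<close>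
  maps \<open>c\<close> to the corresponding sum of the products \<open>f c\<^sub>1 \<cdot> g c\<^sub>2\<close>.\<close>

definition convolution ::
    "('k, 'r) ring_scheme \<Rightarrow> ('k, 'c, 'm) module_scheme \<Rightarrow> ('c \<Rightarrow> ('c \<times> 'c \<Rightarrow> 'k) set) \<Rightarrow>
      ('c \<Rightarrow> 'k) \<Rightarrow> ('c \<Rightarrow> 'k) \<Rightarrow> 'c \<Rightarrow> 'k"
  where "convolution K C \<Delta> f g =
    (\<lambda>c \<in> carrier C. tensor_lift K (ground_module K) (\<lambda>x y. f x \<otimes>\<^bsub>K\<^esub> g y) (\<Delta> c))"

definition nonunitary_dual_algebra ::
    "('k, 'r) ring_scheme \<Rightarrow> ('k, 'c, 'm) module_scheme \<Rightarrow> ('c \<Rightarrow> ('c \<times> 'c \<Rightarrow> 'k) set) \<Rightarrow>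
      ('k, 'c \<Rightarrow> 'k) module"
  where "nonunitary_dual_algebra K C \<Delta> = (dual_module K C)\<lparr>mult := convolution K C \<Delta>\<rparr>"

definition dual_algebra ::
    "('k, 'r) ring_scheme \<Rightarrow> ('k, 'c, 'm) module_scheme \<Rightarrow> ('c \<Rightarrow> ('c \<times> 'c \<Rightarrow> 'k) set) \<Rightarrow>
      ('c \<Rightarrow> 'k) \<Rightarrow> ('k, 'c \<Rightarrow> 'k) module"
  where "dual_algebra K C \<Delta> \<epsilon> =
    (nonunitary_dual_algebra K C \<Delta>)\<lparr>one := restrict \<epsilon> (carrier C)\<rparr>"

definition dual_map :: "('k, 'c, 'm) module_scheme \<Rightarrow> ('c \<Rightarrow> 'c) \<Rightarrow> ('c \<Rightarrow> 'k) \<Rightarrow> 'c \<Rightarrow> 'k"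
  where "dual_map C P f = restrict (f \<circ> P) (carrier C)"

end

theory Submission
  imports Defs
begin

text \<open>Evaluating a pair of forms \<open>f\<close>, \<open>g\<close> on a tensor \<open>t\<close> gives the scalar \<open>\<langle>f \<otimes> g, t\<rangle>\<close>, and the
  convolution product is \<open>c \<mapsto> \<langle>f \<otimes> g, \<Delta> c\<rangle>\<close>.  Since
  \<open>\<langle>f \<otimes> g, (u \<otimes> v) t\<rangle> = \<langle>(f \<circ> u) \<otimes> (g \<circ> v), t\<rangle>\<close>, pairing the coalgebra axioms with tensors of
  forms turns each of them into the corresponding algebra axiom of the dual.\<close>

section \<open>Linear maps\<close>

lemma linear_mapsI:
  assumes "\<And>x. x \<in> carrier M \<Longrightarrow> h x \<in> carrier N"
    and "\<And>x y. \<lbrakk>x \<in> carrier M; y \<in> carrier M\<rbrakk> \<Longrightarrow> h (x \<oplus>\<^bsub>M\<^esub> y) = h x \<oplus>\<^bsub>N\<^esub> h y"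
    and "\<And>a x. \<lbrakk>a \<in> carrier K; x \<in> carrier M\<rbrakk> \<Longrightarrow> h (a \<odot>\<^bsub>M\<^esub> x) = a \<odot>\<^bsub>N\<^esub> h x"
  shows "h \<in> linear_maps K M N"
  using assms by (auto simp: linear_maps_def)

lemma linear_maps_closed: "\<lbrakk>h \<in> linear_maps K M N; x \<in> carrier M\<rbrakk> \<Longrightarrow> h x \<in> carrier N"
  by (auto simp: linear_maps_def)

lemma linear_maps_add:
  "\<lbrakk>h \<in> linear_maps K M N; x \<in> carrier M; y \<in> carrier M\<rbrakk> \<Longrightarrow> h (x \<oplus>\<^bsub>M\<^esub> y) = h x \<oplus>\<^bsub>N\<^esub> h y"
  by (auto simp: linear_maps_def)

lemma linear_maps_smult:
  "\<lbrakk>h \<in> linear_maps K M N; a \<in> carrier K; x \<in> carrier M\<rbrakk> \<Longrightarrow> h (a \<odot>\<^bsub>M\<^esub> x) = a \<odot>\<^bsub>N\<^esub> h x"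
  by (auto simp: linear_maps_def)

lemmas linear_maps_simps = linear_maps_closed linear_maps_add linear_maps_smult

text \<open>Linearity constrains values on the carrier only, and \<open>M\<close> being a module
  keeps sums and multiples in the carrier, where \<open>g\<close> agrees with \<open>f\<close>. This
  transfers linearity between a form and its restriction.\<close>

lemma linear_maps_cong:
  assumes "module K M" "f \<in> linear_maps K M N" "\<And>x. x \<in> carrier M \<Longrightarrow> g x = f x"
  shows "g \<in> linear_maps K M N"
proof -
  interpret M: module K M by fact
  show ?thesis using assms(2,3) by (intro linear_mapsI) (simp_all add: linear_maps_simps)
qed

lemma linear_maps_id: "id \<in> linear_maps K M M"
  by (rule linear_mapsI) simp_all

lemma linear_maps_comp:
  "\<lbrakk>f \<in> linear_maps K L M; g \<in> linear_maps K M N\<rbrakk> \<Longrightarrow> g \<circ> f \<in> linear_maps K L N"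
  by (rule linear_mapsI) (simp_all add: linear_maps_simps)

lemma linear_maps_sum:
  assumes "module K N" "f \<in> linear_maps K M N" "g \<in> linear_maps K M N"
  shows "(\<lambda>x. f x \<oplus>\<^bsub>N\<^esub> g x) \<in> linear_maps K M N"
proof -
  interpret N: module K N by fact
  show ?thesis using assms(2,3)
    by (intro linear_mapsI) (simp_all add: linear_maps_simps N.M.a_ac N.smult_r_distr)
qed

text \<open>Compatibility with a second scalar \<open>b\<close> is a (b x) = b (a x), which holds
  because the scalars commute.\<close>

lemma linear_maps_scale:
  assumes "module K N" "f \<in> linear_maps K M N" "a \<in> carrier K"
  shows "(\<lambda>x. a \<odot>\<^bsub>N\<^esub> f x) \<in> linear_maps K M N"
proof -
  interpret N: module K N by fact
  show ?thesis using assms(2,3)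
    by (intro linear_mapsI)
      (simp_all add: linear_maps_simps N.smult_r_distr N.m_comm flip: N.smult_assoc1)
qed

lemma linear_maps_zero:
  assumes "module K N"
  shows "(\<lambda>x. \<zero>\<^bsub>N\<^esub>) \<in> linear_maps K M N"
proof -
  interpret N: module K N by fact
  show ?thesis by (intro linear_mapsI) simp_all
qed

section \<open>Bilinear maps\<close>

lemma bilinear_mapI:
  assumes "\<And>y. y \<in> carrier N \<Longrightarrow> (\<lambda>x. \<beta> x y) \<in> linear_maps K M W"
    and "\<And>x. x \<in> carrier M \<Longrightarrow> \<beta> x \<in> linear_maps K N W"
  shows "bilinear_map K M N W \<beta>"
  using assms by (simp add: bilinear_map_def)

lemma bilinear_map_left:
  "\<lbrakk>bilinear_map K M N W \<beta>; y \<in> carrier N\<rbrakk> \<Longrightarrow> (\<lambda>x. \<beta> x y) \<in> linear_maps K M W"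
  by (simp add: bilinear_map_def)

lemma bilinear_map_right:
  "\<lbrakk>bilinear_map K M N W \<beta>; x \<in> carrier M\<rbrakk> \<Longrightarrow> \<beta> x \<in> linear_maps K N W"
  by (simp add: bilinear_map_def)

text \<open>Fixing one argument leaves a composite of two linear maps. Bilinearity of the maps that
  induce u \<otimes> v and the associativity isomorphism comes from here.\<close>

lemma bilinear_map_comp:
  assumes f: "f \<in> linear_maps K M M'" and g: "g \<in> linear_maps K N N'"
    and \<beta>: "bilinear_map K M' N' W \<beta>"
  shows "bilinear_map K M N W (\<lambda>x y. \<beta> (f x) (g y))"
proof (rule bilinear_mapI)
  fix y assume "y \<in> carrier N"
  then show "(\<lambda>x. \<beta> (f x) (g y)) \<in> linear_maps K M W"
    using linear_maps_comp[OF f bilinear_map_left[OF \<beta> linear_maps_closed[OF g]]]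
    by (simp add: comp_def)
next
  fix x assume "x \<in> carrier M"
  then show "(\<lambda>y. \<beta> (f x) (g y)) \<in> linear_maps K N W"
    using linear_maps_comp[OF g bilinear_map_right[OF \<beta> linear_maps_closed[OF f]]]
    by (simp add: comp_def)
qed

lemma pure_tensor_closed:
  assumes "module K M" "module K N" "x \<in> carrier M" "y \<in> carrier N"
  shows "pure_tensor K M N x y \<in> carrier (tensor K M N)"
  by (rule linear_maps_closed[OF bilinear_map_right[OF pure_tensor_bilinear[OF assms(1,2)] assms(3)]
        assms(4)])


section \<open>Maps out of tensor products\<close>

lemma tensor_map_bilinear:
  assumes "module K M'" "module K N'" "f \<in> linear_maps K M M'" "g \<in> linear_maps K N N'"
  shows "bilinear_map K M N (tensor K M' N') (\<lambda>x y. pure_tensor K M' N' (f x) (g y))"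
  using assms by (intro bilinear_map_comp[OF assms(3,4)] pure_tensor_bilinear)

lemma tensor_map_linear:
  assumes "module K M" "module K N" "module K M'" "module K N'"
    and "f \<in> linear_maps K M M'" "g \<in> linear_maps K N N'"
  shows "tensor_map K M' N' f g \<in> linear_maps K (tensor K M N) (tensor K M' N')"
  unfolding tensor_map_def using assms by (intro tensor_lift_linear tensor_module tensor_map_bilinear)

lemma tensor_map_pure:
  assumes "module K M" "module K N" "module K M'" "module K N'"
    and "f \<in> linear_maps K M M'" "g \<in> linear_maps K N N'" "x \<in> carrier M" "y \<in> carrier N"
  shows "tensor_map K M' N' f g (pure_tensor K M N x y) = pure_tensor K M' N' (f x) (g y)"
  unfolding tensor_map_def using assms by (intro tensor_lift_pure tensor_module tensor_map_bilinear)

text \<open>Both sides of each linearity equation in \<open>z\<close> are themselves linear in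
  \<open>t\<close>, so it suffices to compare them on pure tensors, where \<open>lin\<close>
  applies. The lemma serves the outer lift in \<open>tensor_assoc\<close>, whose second argument
  enters only as a parameter of the inner lift.\<close>

lemma tensor_lift_parameter_linear:
  assumes M: "module K M" and N: "module K N" and Z: "module K Z" and W: "module K W"
    and \<beta>: "\<And>z. z \<in> carrier Z \<Longrightarrow> bilinear_map K M N W (\<beta> z)"
    and lin: "\<And>x y. \<lbrakk>x \<in> carrier M; y \<in> carrier N\<rbrakk> \<Longrightarrow> (\<lambda>z. \<beta> z x y) \<in> linear_maps K Z W"
    and t: "t \<in> carrier (tensor K M N)"
  shows "(\<lambda>z. tensor_lift K W (\<beta> z) t) \<in> linear_maps K Z W"
proof -
  interpret Z: module K Z by fact
  note lift = tensor_lift_linear[OF M N W \<beta>] and pure = tensor_lift_pure[OF M N W \<beta>]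
  show ?thesis
  proof (rule linear_mapsI)
    fix z assume "z \<in> carrier Z"
    then show "tensor_lift K W (\<beta> z) t \<in> carrier W" by (rule linear_maps_closed[OF lift t])
  next
    fix z z' assume z: "z \<in> carrier Z" "z' \<in> carrier Z"
    show "tensor_lift K W (\<beta> (z \<oplus>\<^bsub>Z\<^esub> z')) t =
        tensor_lift K W (\<beta> z) t \<oplus>\<^bsub>W\<^esub> tensor_lift K W (\<beta> z') t"
      by (rule tensor_linear_eqI[OF M N W lift linear_maps_sum[OF W lift lift] _ t])
        (simp_all add: pure z linear_maps_add[OF lin])
  next
    fix a z assume a: "a \<in> carrier K" and z: "z \<in> carrier Z"
    show "tensor_lift K W (\<beta> (a \<odot>\<^bsub>Z\<^esub> z)) t = a \<odot>\<^bsub>W\<^esub> tensor_lift K W (\<beta> z) t"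
      by (rule tensor_linear_eqI[OF M N W lift linear_maps_scale[OF W lift a] _ t])
        (simp_all add: pure a z linear_maps_smult[OF lin])
  qed
qed

section \<open>The associativity isomorphism on pure tensors\<close>

context
  fixes K :: "('k, 'r) ring_scheme" and L :: "('k, 'a, 'l) module_scheme"
    and M :: "('k, 'b, 'm) module_scheme" and N :: "('k, 'c, 'n) module_scheme"
  assumes L: "module K L" and M: "module K M" and N: "module K N"
begin

lemma tensor_assoc_inner_bilinear:
  assumes z: "z \<in> carrier N"
  shows "bilinear_map K L M (tensor K L (tensor K M N))
    (\<lambda>x y. pure_tensor K L (tensor K M N) x (pure_tensor K M N y z))"
  using bilinear_map_comp[OF linear_maps_id bilinear_map_left[OF pure_tensor_bilinear[OF M N] z]
      pure_tensor_bilinear[OF L tensor_module[OF M N]]] by simp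

text \<open>Linearity in \<open>t\<close> is that of an induced map. In \<open>z\<close> it holds on
  pure \<open>t\<close>, as a composite of two tensoring maps, and
  \<open>tensor_lift_parameter_linear\<close> extends this to every \<open>t\<close>.\<close>

lemma tensor_assoc_bilinear:
  "bilinear_map K (tensor K L M) N (tensor K L (tensor K M N))
    (\<lambda>t z. tensor_lift K (tensor K L (tensor K M N))
      (\<lambda>x y. pure_tensor K L (tensor K M N) x (pure_tensor K M N y z)) t)"
proof (rule bilinear_mapI)
  fix z assume "z \<in> carrier N"
  from tensor_assoc_inner_bilinear[OF this]
  show "tensor_lift K (tensor K L (tensor K M N))
      (\<lambda>x y. pure_tensor K L (tensor K M N) x (pure_tensor K M N y z))
      \<in> linear_maps K (tensor K L M) (tensor K L (tensor K M N))"
    using L M N by (intro tensor_lift_linear tensor_module)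
next
  fix t assume t: "t \<in> carrier (tensor K L M)"
  have "(\<lambda>z. pure_tensor K L (tensor K M N) x (pure_tensor K M N y z))
      \<in> linear_maps K N (tensor K L (tensor K M N))"
    if x: "x \<in> carrier L" and y: "y \<in> carrier M" for x y
    using linear_maps_comp[OF bilinear_map_right[OF pure_tensor_bilinear[OF M N] y]
      bilinear_map_right[OF pure_tensor_bilinear[OF L tensor_module[OF M N]] x]]
    by (simp add: comp_def)
  then show "(\<lambda>z. tensor_lift K (tensor K L (tensor K M N))
      (\<lambda>x y. pure_tensor K L (tensor K M N) x (pure_tensor K M N y z)) t)
      \<in> linear_maps K N (tensor K L (tensor K M N))"
    using L M N t
    by (intro tensor_lift_parameter_linear[OF L M N] tensor_assoc_inner_bilinear tensor_module)
qed

lemma tensor_assoc_linear: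
  "tensor_assoc K L M N \<in>
    linear_maps K (tensor K (tensor K L M) N) (tensor K L (tensor K M N))"
  unfolding tensor_assoc_def Let_def using L M N
  by (intro tensor_lift_linear tensor_module tensor_assoc_bilinear)

text \<open>Only the outer lift is evaluated, so \<open>t\<close> may be any tensor; a pure
  \<open>t\<close> is treated next by evaluating the inner lift.\<close>

lemma tensor_assoc_pure:
  assumes t: "t \<in> carrier (tensor K L M)" and z: "z \<in> carrier N"
  shows "tensor_assoc K L M N (pure_tensor K (tensor K L M) N t z) =
    tensor_lift K (tensor K L (tensor K M N))
      (\<lambda>x y. pure_tensor K L (tensor K M N) x (pure_tensor K M N y z)) t"
  unfolding tensor_assoc_def Let_def using L M N t z
  by (intro tensor_lift_pure[where \<beta> = "\<lambda>t z. tensor_lift K (tensor K L (tensor K M N))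
      (\<lambda>x y. pure_tensor K L (tensor K M N) x (pure_tensor K M N y z)) t"]
    tensor_module tensor_assoc_bilinear)

lemma tensor_assoc_pure_pure:
  assumes "x \<in> carrier L" "y \<in> carrier M" "z \<in> carrier N"
  shows "tensor_assoc K L M N (pure_tensor K (tensor K L M) N (pure_tensor K L M x y) z) =
    pure_tensor K L (tensor K M N) x (pure_tensor K M N y z)"
  using assms L M N tensor_assoc_inner_bilinear
  by (simp add: tensor_assoc_pure pure_tensor_closed tensor_lift_pure tensor_module)

end


section \<open>Tensor products of linear forms\<close>

lemma ground_module_simps [simp]:
  "carrier (ground_module K) = carrier K"
  "zero (ground_module K) = zero K"
  "add (ground_module K) = add K"
  "smult (ground_module K) = mult K"
  by (simp_all add: ground_module_def)

lemma ground_module_module: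
  assumes "cring K" shows "module K (ground_module K)"
proof -
  interpret cring K by fact
  show ?thesis
    by (intro moduleI abelian_groupI)
      (auto simp: assms a_ac l_distr r_distr m_assoc intro: bexI[of _ "\<ominus>\<^bsub>K\<^esub> _"] l_neg)
qed

text \<open>This is f \<otimes> g followed by the multiplication map from K \<otimes> K to K. Taking
  values in K itself makes the result a linear form again, so the construction can be iterated, and
  it matches the body of \<open>convolution\<close>.\<close>

definition tensor_form ::
    "('k, 'r) ring_scheme \<Rightarrow> ('a \<Rightarrow> 'k) \<Rightarrow> ('b \<Rightarrow> 'k) \<Rightarrow> ('a \<times> 'b \<Rightarrow> 'k) set \<Rightarrow> 'k"
  where "tensor_form K f g = tensor_lift K (ground_module K) (\<lambda>x y. f x \<otimes>\<^bsub>K\<^esub> g y)"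

abbreviation linear_forms ::
    "('k, 'r) ring_scheme \<Rightarrow> ('k, 'a, 'm) module_scheme \<Rightarrow> ('a \<Rightarrow> 'k) set"
  where "linear_forms K M \<equiv> linear_maps K M (ground_module K)"

lemma form_product_bilinear:
  assumes K: "cring K" and f: "f \<in> linear_forms K M" and g: "g \<in> linear_forms K N"
  shows "bilinear_map K M N (ground_module K) (\<lambda>x y. f x \<otimes>\<^bsub>K\<^esub> g y)"
proof -
  interpret cring K by fact
  show ?thesis using linear_maps_closed[OF f] linear_maps_closed[OF g]
    by (intro bilinear_mapI linear_mapsI)
      (simp_all add: linear_maps_add[OF f] linear_maps_add[OF g] linear_maps_smult[OF f]
        linear_maps_smult[OF g] l_distr r_distr m_ac)
qed

context
  fixes K :: "('k, 'r) ring_scheme" and M :: "('k, 'a, 'm) module_scheme"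
    and N :: "('k, 'b, 'n) module_scheme"
  assumes M: "module K M" and N: "module K N"
begin

interpretation M: module K M by (rule M)

lemma tensor_form_linear:
  "\<lbrakk>f \<in> linear_forms K M; g \<in> linear_forms K N\<rbrakk> \<Longrightarrow> tensor_form K f g \<in> linear_forms K (tensor K M N)"
  unfolding tensor_form_def
  by (intro tensor_lift_linear M N ground_module_module form_product_bilinear M.is_cring)

lemma tensor_form_pure:
  "\<lbrakk>f \<in> linear_forms K M; g \<in> linear_forms K N; x \<in> carrier M; y \<in> carrier N\<rbrakk> \<Longrightarrow>
    tensor_form K f g (pure_tensor K M N x y) = f x \<otimes>\<^bsub>K\<^esub> g y"
  unfolding tensor_form_def
  by (intro tensor_lift_pure[where \<beta> = "\<lambda>x y. f x \<otimes>\<^bsub>K\<^esub> g y"]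
      M N ground_module_module form_product_bilinear M.is_cring)

text \<open>Uniqueness in the universal property, for forms. The identities below follow by
  exhibiting one side as a linear form with the right values on pure tensors.\<close>

lemma tensor_form_eqI:
  assumes "f \<in> linear_forms K M" "g \<in> linear_forms K N"
    and "h \<in> linear_forms K (tensor K M N)"
    and "\<And>x y. \<lbrakk>x \<in> carrier M; y \<in> carrier N\<rbrakk> \<Longrightarrow> h (pure_tensor K M N x y) = f x \<otimes>\<^bsub>K\<^esub> g y"
    and "t \<in> carrier (tensor K M N)"
  shows "h t = tensor_form K f g t"
  by (rule tensor_linear_eqI[OF M N ground_module_module[OF M.is_cring] assms(3)
        tensor_form_linear[OF assms(1,2)] _ assms(5)])
    (simp add: assms tensor_form_pure)

text \<open>The primed functions may differ from the forms off the carriers, but they are linear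
  forms too, and the two pairings have the same values on pure tensors. This is what lets
  restrictions to the carrier be ignored.\<close>

lemma tensor_form_cong:
  assumes f: "f \<in> linear_forms K M" and g: "g \<in> linear_forms K N"
    and "\<And>x. x \<in> carrier M \<Longrightarrow> f' x = f x" "\<And>y. y \<in> carrier N \<Longrightarrow> g' y = g y"
    and "t \<in> carrier (tensor K M N)"
  shows "tensor_form K f' g' t = tensor_form K f g t"
proof -
  have "f' \<in> linear_forms K M" "g' \<in> linear_forms K N"
    using linear_maps_cong[OF M f] linear_maps_cong[OF N g] assms by auto
  then show ?thesis
    by (intro tensor_form_eqI f g tensor_form_linear) (use assms in \<open>simp_all add: tensor_form_pure\<close>)
qed

text \<open>The right-hand side is linear in \<open>t\<close>, and distributivity in
  \<open>K\<close> gives it the value required by \<open>tensor_form_eqI\<close> on a pure tensor.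
  The next three lemmas follow the same scheme, the scalar ones using associativity and
  commutativity of \<open>K\<close>.\<close>

lemma tensor_form_add_left:
  assumes f: "f \<in> linear_forms K M" and f': "f' \<in> linear_forms K M" and g: "g \<in> linear_forms K N"
    and t: "t \<in> carrier (tensor K M N)"
  shows "tensor_form K (\<lambda>x. f x \<oplus>\<^bsub>K\<^esub> f' x) g t = tensor_form K f g t \<oplus>\<^bsub>K\<^esub> tensor_form K f' g t"
proof -
  note G = ground_module_module[OF M.is_cring]
  have "(\<lambda>t. tensor_form K f g t \<oplus>\<^bsub>K\<^esub> tensor_form K f' g t) \<in> linear_forms K (tensor K M N)"
    using linear_maps_sum[OF G tensor_form_linear[OF f g] tensor_form_linear[OF f' g]] by simp
  moreover have "(\<lambda>x. f x \<oplus>\<^bsub>K\<^esub> f' x) \<in> linear_forms K M" using linear_maps_sum[OF G f f'] by simp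
  ultimately show ?thesis
    using linear_maps_closed[OF f] linear_maps_closed[OF f'] linear_maps_closed[OF g]
    by (intro tensor_form_eqI[symmetric] g t) (simp_all add: tensor_form_pure f f' g M.l_distr)
qed

lemma tensor_form_add_right:
  assumes f: "f \<in> linear_forms K M" and g: "g \<in> linear_forms K N" and g': "g' \<in> linear_forms K N"
    and t: "t \<in> carrier (tensor K M N)"
  shows "tensor_form K f (\<lambda>y. g y \<oplus>\<^bsub>K\<^esub> g' y) t = tensor_form K f g t \<oplus>\<^bsub>K\<^esub> tensor_form K f g' t"
proof -
  note G = ground_module_module[OF M.is_cring]
  have "(\<lambda>t. tensor_form K f g t \<oplus>\<^bsub>K\<^esub> tensor_form K f g' t) \<in> linear_forms K (tensor K M N)"
    using linear_maps_sum[OF G tensor_form_linear[OF f g] tensor_form_linear[OF f g']] by simp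
  moreover have "(\<lambda>y. g y \<oplus>\<^bsub>K\<^esub> g' y) \<in> linear_forms K N" using linear_maps_sum[OF G g g'] by simp
  ultimately show ?thesis
    using linear_maps_closed[OF f] linear_maps_closed[OF g] linear_maps_closed[OF g']
    by (intro tensor_form_eqI[symmetric] f t) (simp_all add: tensor_form_pure f g g' M.r_distr)
qed

lemma tensor_form_scale_left:
  assumes f: "f \<in> linear_forms K M" and g: "g \<in> linear_forms K N" and a: "a \<in> carrier K"
    and t: "t \<in> carrier (tensor K M N)"
  shows "tensor_form K (\<lambda>x. a \<otimes>\<^bsub>K\<^esub> f x) g t = a \<otimes>\<^bsub>K\<^esub> tensor_form K f g t"
proof -
  note G = ground_module_module[OF M.is_cring]
  have "(\<lambda>t. a \<otimes>\<^bsub>K\<^esub> tensor_form K f g t) \<in> linear_forms K (tensor K M N)"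
    using linear_maps_scale[OF G tensor_form_linear[OF f g] a] by simp
  moreover have "(\<lambda>x. a \<otimes>\<^bsub>K\<^esub> f x) \<in> linear_forms K M" using linear_maps_scale[OF G f a] by simp
  ultimately show ?thesis using linear_maps_closed[OF f] linear_maps_closed[OF g]
    by (intro tensor_form_eqI[symmetric] g t) (simp_all add: tensor_form_pure f g a M.m_assoc)
qed

lemma tensor_form_scale_right:
  assumes f: "f \<in> linear_forms K M" and g: "g \<in> linear_forms K N" and a: "a \<in> carrier K"
    and t: "t \<in> carrier (tensor K M N)"
  shows "tensor_form K f (\<lambda>y. a \<otimes>\<^bsub>K\<^esub> g y) t = a \<otimes>\<^bsub>K\<^esub> tensor_form K f g t"
proof -
  note G = ground_module_module[OF M.is_cring]
  have "(\<lambda>t. a \<otimes>\<^bsub>K\<^esub> tensor_form K f g t) \<in> linear_forms K (tensor K M N)"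
    using linear_maps_scale[OF G tensor_form_linear[OF f g] a] by simp
  moreover have "(\<lambda>y. a \<otimes>\<^bsub>K\<^esub> g y) \<in> linear_forms K N" using linear_maps_scale[OF G g a] by simp
  ultimately show ?thesis using linear_maps_closed[OF f] linear_maps_closed[OF g]
    by (intro tensor_form_eqI[symmetric] f t) (simp_all add: tensor_form_pure f g a M.m_lcomm)
qed

text \<open>Both sides are linear in \<open>t\<close> and send x \<otimes> y to f (u x) times g (v
  y). The lemma moves maps acting on a tensor over to the forms paired with it.\<close>

lemma tensor_form_tensor_map:
  assumes M': "module K M'" and N': "module K N'"
    and u: "u \<in> linear_maps K M M'" and v: "v \<in> linear_maps K N N'"
    and f: "f \<in> linear_forms K M'" and g: "g \<in> linear_forms K N'"
    and t: "t \<in> carrier (tensor K M N)"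
  shows "tensor_form K f g (tensor_map K M' N' u v t) = tensor_form K (f \<circ> u) (g \<circ> v) t"
proof -
  \<comment> \<open>Inside this context the preceding lemmas speak of the fixed \<open>M\<close> and
    \<open>N\<close> only, so linearity and the value on pure tensors are derived again for
    \<open>M'\<close> and \<open>N'\<close>.\<close>
  have l: "tensor_form K f g \<in> linear_forms K (tensor K M' N')"
    unfolding tensor_form_def
    by (intro tensor_lift_linear M' N' ground_module_module form_product_bilinear M.is_cring f g)
  have p: "tensor_form K f g (pure_tensor K M' N' x y) = f x \<otimes>\<^bsub>K\<^esub> g y"
    if "x \<in> carrier M'" "y \<in> carrier N'" for x y
    unfolding tensor_form_def using that
    by (intro tensor_lift_pure[where \<beta> = "\<lambda>x y. f x \<otimes>\<^bsub>K\<^esub> g y"]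
        M' N' ground_module_module form_product_bilinear M.is_cring f g)
  have "(tensor_form K f g \<circ> tensor_map K M' N' u v) t = tensor_form K (f \<circ> u) (g \<circ> v) t"
    by (intro tensor_form_eqI linear_maps_comp[OF u f] linear_maps_comp[OF v g] t
        linear_maps_comp[OF tensor_map_linear[OF M N M' N' u v] l])
      (simp add: tensor_map_pure[OF M N M' N' u v] p linear_maps_closed[OF u] linear_maps_closed[OF v])
  then show ?thesis by simp
qed

end

text \<open>On a tensor (x \<otimes> y) \<otimes> z the two sides are the two bracketings of the
  product of f x, g y and h z, equal by associativity in \<open>K\<close>.\<close>

lemma tensor_form_assoc:
  assumes L: "module K L" and M: "module K M" and N: "module K N"
    and f: "f \<in> linear_forms K L" and g: "g \<in> linear_forms K M" and h: "h \<in> linear_forms K N"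
    and t: "t \<in> carrier (tensor K (tensor K L M) N)"
  shows "tensor_form K f (tensor_form K g h) (tensor_assoc K L M N t) =
    tensor_form K (tensor_form K f g) h t"
proof -
  interpret L: module K L by fact
  note G = ground_module_module[OF L.is_cring]
  note LM = tensor_module[OF L M] and MN = tensor_module[OF M N]
  note fg = tensor_form_linear[OF L M f g] and gh = tensor_form_linear[OF M N g h]
  note fgh = tensor_form_linear[OF L MN f gh]
  let ?\<Phi> = "tensor_form K f (tensor_form K g h) \<circ> tensor_assoc K L M N"
  have \<Phi>: "?\<Phi> \<in> linear_forms K (tensor K (tensor K L M) N)"
    by (rule linear_maps_comp[OF tensor_assoc_linear[OF L M N] fgh])
  \<comment> \<open>A pure tensor of the outer product is s \<otimes> z with \<open>s\<close>
    arbitrary. For fixed \<open>z\<close> both sides are linear in \<open>s\<close>, so a second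
    reduction makes \<open>s\<close> pure as well.\<close>
  have pure: "?\<Phi> (pure_tensor K (tensor K L M) N s z) = tensor_form K f g s \<otimes>\<^bsub>K\<^esub> h z"
    if s: "s \<in> carrier (tensor K L M)" and z: "z \<in> carrier N" for s z
  proof (rule tensor_linear_eqI[OF L M G _ _ _ s])
    show "(\<lambda>s. ?\<Phi> (pure_tensor K (tensor K L M) N s z)) \<in> linear_forms K (tensor K L M)"
      using linear_maps_comp[OF bilinear_map_left[OF pure_tensor_bilinear[OF LM N] z] \<Phi>]
      by (simp add: comp_def)
    show "(\<lambda>s. tensor_form K f g s \<otimes>\<^bsub>K\<^esub> h z) \<in> linear_forms K (tensor K L M)"
      by (rule bilinear_map_left[OF form_product_bilinear[OF L.is_cring fg h] z])
  next
    fix x y assume "x \<in> carrier L" "y \<in> carrier M"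
    then show "?\<Phi> (pure_tensor K (tensor K L M) N (pure_tensor K L M x y) z) =
        tensor_form K f g (pure_tensor K L M x y) \<otimes>\<^bsub>K\<^esub> h z"
      using z linear_maps_closed[OF f] linear_maps_closed[OF g] linear_maps_closed[OF h]
      by (simp add: tensor_assoc_pure_pure[OF L M N] tensor_form_pure[OF L M f g]
          tensor_form_pure[OF M N g h] tensor_form_pure[OF L MN f gh]
          pure_tensor_closed[OF M N] L.m_assoc)
  qed
  show ?thesis using tensor_form_eqI[OF LM N fg h \<Phi> pure t] by simp
qed


section \<open>The dual algebra\<close>

lemma nonunitary_dual_algebra_simps:
  "carrier (nonunitary_dual_algebra K C \<Delta>) = linear_forms K C \<inter> extensional (carrier C)"
  "zero (nonunitary_dual_algebra K C \<Delta>) = (\<lambda>c \<in> carrier C. \<zero>\<^bsub>K\<^esub>)"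
  "add (nonunitary_dual_algebra K C \<Delta>) = (\<lambda>f g. \<lambda>c \<in> carrier C. f c \<oplus>\<^bsub>K\<^esub> g c)"
  "smult (nonunitary_dual_algebra K C \<Delta>) = (\<lambda>a f. \<lambda>c \<in> carrier C. a \<otimes>\<^bsub>K\<^esub> f c)"
  "mult (nonunitary_dual_algebra K C \<Delta>) = convolution K C \<Delta>"
  by (simp_all add: nonunitary_dual_algebra_def dual_module_def)

lemma dual_algebra_simps:
  "carrier (dual_algebra K C \<Delta> \<epsilon>) = linear_forms K C \<inter> extensional (carrier C)"
  "zero (dual_algebra K C \<Delta> \<epsilon>) = (\<lambda>c \<in> carrier C. \<zero>\<^bsub>K\<^esub>)"
  "add (dual_algebra K C \<Delta> \<epsilon>) = (\<lambda>f g. \<lambda>c \<in> carrier C. f c \<oplus>\<^bsub>K\<^esub> g c)"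
  "smult (dual_algebra K C \<Delta> \<epsilon>) = (\<lambda>a f. \<lambda>c \<in> carrier C. a \<otimes>\<^bsub>K\<^esub> f c)"
  "mult (dual_algebra K C \<Delta> \<epsilon>) = convolution K C \<Delta>"
  "one (dual_algebra K C \<Delta> \<epsilon>) = restrict \<epsilon> (carrier C)"
  by (simp_all add: dual_algebra_def nonunitary_dual_algebra_def dual_module_def)

lemma (in module) restrict_linear:
  "h \<in> linear_maps R M N \<Longrightarrow> restrict h (carrier M) \<in> linear_maps R M N"
  by (rule linear_maps_cong[OF module_axioms]) simp_all

text \<open>Stated for an arbitrary record with the operations of the dual, since a module statement about
  \<open>dual_module\<close> does not transfer to the records that update its multiplicative fields.\<close>

lemma (in module) dual_is_module:
  assumes "carrier D = linear_forms R M \<inter> extensional (carrier M)"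
    "zero D = (\<lambda>c \<in> carrier M. \<zero>)"
    "add D = (\<lambda>f g. \<lambda>c \<in> carrier M. f c \<oplus> g c)"
    "smult D = (\<lambda>a f. \<lambda>c \<in> carrier M. a \<otimes> f c)"
  shows "module R D"
proof -
  note D = assms
  note G = ground_module_module[OF R.is_cring]
  have c: "f x \<in> carrier R" if "f \<in> carrier D" "x \<in> carrier M" for f x
    using that linear_maps_closed[of f R M "ground_module R" x] by (simp add: D)
  have add: "f \<oplus>\<^bsub>D\<^esub> g \<in> carrier D" if "f \<in> carrier D" "g \<in> carrier D" for f g
    using that restrict_linear[OF linear_maps_sum[OF G, of f _ g]] by (simp add: D)
  have sm: "a \<odot>\<^bsub>D\<^esub> f \<in> carrier D" if "f \<in> carrier D" "a \<in> carrier R" for a f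
    using that restrict_linear[OF linear_maps_scale[OF G, of f _ a]] by (simp add: D)
  have ext: "f = g" if "f \<in> carrier D" "g \<in> carrier D" "\<And>x. x \<in> carrier M \<Longrightarrow> f x = g x" for f g
    using that by (auto simp: D intro: extensionalityI)
  have ap: "(f \<oplus>\<^bsub>D\<^esub> g) x = f x \<oplus> g x" "(a \<odot>\<^bsub>D\<^esub> f) x = a \<otimes> f x" "\<zero>\<^bsub>D\<^esub> x = \<zero>"
    if "x \<in> carrier M" for a f g x
    using that by (simp_all add: D)
  have z: "\<zero>\<^bsub>D\<^esub> \<in> carrier D"
    using restrict_linear[OF linear_maps_zero[OF G]] by (simp add: D)
  show ?thesis
  proof (rule moduleI)
    show "abelian_group D"
    proof (rule abelian_groupI)
      fix f assume f: "f \<in> carrier D"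
      \<comment> \<open>Writing the negative of \<open>f\<close> as a scalar multiple puts it in the
        carrier by \<open>sm\<close>.\<close>
      then have "(\<ominus> \<one>) \<odot>\<^bsub>D\<^esub> f \<oplus>\<^bsub>D\<^esub> f = \<zero>\<^bsub>D\<^esub>"
        by (intro ext add sm z) (simp_all add: ap c R.l_minus R.l_neg)
      moreover have "(\<ominus> \<one>) \<odot>\<^bsub>D\<^esub> f \<in> carrier D" using f by (simp add: sm)
      ultimately show "\<exists>g\<in>carrier D. g \<oplus>\<^bsub>D\<^esub> f = \<zero>\<^bsub>D\<^esub>" by blast
    qed (auto intro!: ext add z simp: ap c R.a_ac)
  qed (auto intro!: ext add sm simp: R.is_cring ap c R.l_distr R.r_distr R.m_assoc)
qed

section \<open>The convolution product\<close>

context noncounitary_coalgebra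
begin

lemmas scalars_module = ground_module_module[OF R.is_cring]

lemma coproduct_closed: "c \<in> carrier C \<Longrightarrow> \<Delta> c \<in> carrier (tensor K C C)"
  by (rule linear_maps_closed[OF coproduct_linear])

lemma convolution_eq: "c \<in> carrier C \<Longrightarrow> convolution K C \<Delta> f g c = tensor_form K f g (\<Delta> c)"
  by (simp add: convolution_def tensor_form_def)

lemma convolution_linear:
  assumes "f \<in> linear_forms K C" "g \<in> linear_forms K C"
  shows "convolution K C \<Delta> f g \<in> linear_forms K C"
  using linear_maps_comp[OF coproduct_linear tensor_form_linear[OF module_axioms module_axioms assms]]
  by (rule linear_maps_cong[OF module_axioms]) (simp add: convolution_eq)

lemma convolution_extensional: "convolution K C \<Delta> f g \<in> extensional (carrier C)"
  by (simp add: convolution_def)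

text \<open>The operations of the dual return functions restricted to the carrier; this removes such
  restrictions from the factors of a product.\<close>

lemma convolution_cong:
  assumes "f \<in> linear_forms K C" "g \<in> linear_forms K C"
    and "\<And>x. x \<in> carrier C \<Longrightarrow> f' x = f x" "\<And>x. x \<in> carrier C \<Longrightarrow> g' x = g x"
  shows "convolution K C \<Delta> f' g' = convolution K C \<Delta> f g"
proof (rule extensionalityI[OF convolution_extensional convolution_extensional])
  fix c assume c: "c \<in> carrier C"
  show "convolution K C \<Delta> f' g' c = convolution K C \<Delta> f g c"
    unfolding convolution_eq[OF c]
    by (rule tensor_form_cong[OF module_axioms module_axioms assms coproduct_closed[OF c]])
qed

text \<open>Each bracketing pairs the three forms with one of the two iterated coproducts of
  \<open>c\<close>. Coassociativity identifies these up to \<open>tensor_assoc\<close>, which the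
  pairing absorbs by \<open>tensor_form_assoc\<close>.\<close>

lemma convolution_assoc:
  assumes f: "f \<in> linear_forms K C" and g: "g \<in> linear_forms K C" and h: "h \<in> linear_forms K C"
  shows "convolution K C \<Delta> (convolution K C \<Delta> f g) h = convolution K C \<Delta> f (convolution K C \<Delta> g h)"
proof (rule extensionalityI[OF convolution_extensional convolution_extensional])
  fix c assume c: "c \<in> carrier C"
  note C = module_axioms
  note CC = tensor_module[OF C C]
  note fg = tensor_form_linear[OF C C f g] and gh = tensor_form_linear[OF C C g h]
  note \<Delta>c = coproduct_closed[OF c]
  \<comment> \<open>The inner product agrees with \<open>tensor_form K f g \<circ> \<Delta>\<close>
    on the carrier only, hence the congruence rule; \<open>h \<circ> id\<close> provides the shape
    in which \<Delta> \<otimes> id can be split off.\<close>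
  have "convolution K C \<Delta> (convolution K C \<Delta> f g) h c =
      tensor_form K (tensor_form K f g \<circ> \<Delta>) (h \<circ> id) (\<Delta> c)"
    unfolding convolution_eq[OF c]
    by (rule tensor_form_cong[OF C C]) (use linear_maps_comp[OF coproduct_linear fg] h in
        \<open>simp_all add: \<Delta>c convolution_eq\<close>)
  also have "\<dots> = tensor_form K (tensor_form K f g) h (tensor_map K (tensor K C C) C \<Delta> id (\<Delta> c))"
    by (rule tensor_form_tensor_map[OF C C CC C coproduct_linear linear_maps_id fg h \<Delta>c, symmetric])
  also have "\<dots> = tensor_form K f (tensor_form K g h)
      (tensor_assoc K C C C (tensor_map K (tensor K C C) C \<Delta> id (\<Delta> c)))"
    by (rule tensor_form_assoc[OF C C C f g h, symmetric])
      (rule linear_maps_closed[OF tensor_map_linear[OF C C CC C coproduct_linear linear_maps_id] \<Delta>c])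
  also have "\<dots> = tensor_form K f (tensor_form K g h) (tensor_map K C (tensor K C C) id \<Delta> (\<Delta> c))"
    by (simp add: coassociative c)
  also have "\<dots> = tensor_form K (f \<circ> id) (tensor_form K g h \<circ> \<Delta>) (\<Delta> c)"
    by (rule tensor_form_tensor_map[OF C C C CC linear_maps_id coproduct_linear f gh \<Delta>c])
  also have "\<dots> = convolution K C \<Delta> f (convolution K C \<Delta> g h) c"
    unfolding convolution_eq[OF c]
    by (rule tensor_form_cong[OF C C, symmetric]) (use linear_maps_comp[OF coproduct_linear gh] f
        convolution_linear[OF g h] in \<open>simp_all add: \<Delta>c convolution_eq\<close>)
  finally show "convolution K C \<Delta> (convolution K C \<Delta> f g) h c =
      convolution K C \<Delta> f (convolution K C \<Delta> g h) c" .
qed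

text \<open>Bilinearity of the product is bilinearity of the pairing in its two forms. The record
  \<open>D\<close> is left arbitrary so that the duals with and without a unit are both
  instances.\<close>

lemma dual_is_nonunitary_algebra:
  assumes D: "carrier D = linear_forms K C \<inter> extensional (carrier C)"
    "zero D = (\<lambda>c \<in> carrier C. \<zero>\<^bsub>K\<^esub>)"
    "add D = (\<lambda>f g. \<lambda>c \<in> carrier C. f c \<oplus>\<^bsub>K\<^esub> g c)"
    "smult D = (\<lambda>a f. \<lambda>c \<in> carrier C. a \<otimes>\<^bsub>K\<^esub> f c)"
    "mult D = convolution K C \<Delta>"
  shows "nonunitary_algebra K D"
proof -
  note C = module_axioms
  have sum: "(\<lambda>x. f x \<oplus>\<^bsub>K\<^esub> g x) \<in> linear_forms K C"
    if "f \<in> linear_forms K C" "g \<in> linear_forms K C" for f g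
    using linear_maps_sum[OF scalars_module that] by simp
  have scale: "(\<lambda>x. a \<otimes>\<^bsub>K\<^esub> f x) \<in> linear_forms K C"
    if "a \<in> carrier K" "f \<in> linear_forms K C" for a f
    using linear_maps_scale[OF scalars_module that(2,1)] by simp
  have unrestrict: "convolution K C \<Delta> (restrict f (carrier C)) g = convolution K C \<Delta> f g"
    "convolution K C \<Delta> g (restrict f (carrier C)) = convolution K C \<Delta> g f"
    if "f \<in> linear_forms K C" "g \<in> linear_forms K C" for f g
    using that by (auto intro!: convolution_cong)
  note ext = extensionalityI[OF convolution_extensional restrict_extensional]
  show ?thesis
  proof (rule nonunitary_algebra.intro[OF dual_is_module[OF D(1-4)] nonunitary_algebra_axioms.intro])
    fix f g h assume "f \<in> carrier D" "g \<in> carrier D" "h \<in> carrier D"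
    then have fgh: "f \<in> linear_forms K C" "g \<in> linear_forms K C" "h \<in> linear_forms K C"
      by (simp_all add: D)
    show "(f \<oplus>\<^bsub>D\<^esub> g) \<otimes>\<^bsub>D\<^esub> h = f \<otimes>\<^bsub>D\<^esub> h \<oplus>\<^bsub>D\<^esub> g \<otimes>\<^bsub>D\<^esub> h"
      unfolding D unrestrict(1)[OF sum[OF fgh(1,2)] fgh(3)]
      by (rule ext)
        (simp add: convolution_eq coproduct_closed tensor_form_add_left[OF C C] fgh)
    show "h \<otimes>\<^bsub>D\<^esub> (f \<oplus>\<^bsub>D\<^esub> g) = h \<otimes>\<^bsub>D\<^esub> f \<oplus>\<^bsub>D\<^esub> h \<otimes>\<^bsub>D\<^esub> g"
      unfolding D unrestrict(2)[OF sum[OF fgh(1,2)] fgh(3)]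
      by (rule ext)
        (simp add: convolution_eq coproduct_closed tensor_form_add_right[OF C C] fgh)
  next
    fix a f g assume "f \<in> carrier D" "g \<in> carrier D" and a: "a \<in> carrier K"
    then have fg: "f \<in> linear_forms K C" "g \<in> linear_forms K C"
      by (simp_all add: D)
    show "(a \<odot>\<^bsub>D\<^esub> f) \<otimes>\<^bsub>D\<^esub> g = a \<odot>\<^bsub>D\<^esub> (f \<otimes>\<^bsub>D\<^esub> g)"
      unfolding D unrestrict(1)[OF scale[OF a fg(1)] fg(2)]
      by (rule ext)
        (simp add: convolution_eq coproduct_closed tensor_form_scale_left[OF C C] fg a)
    show "f \<otimes>\<^bsub>D\<^esub> (a \<odot>\<^bsub>D\<^esub> g) = a \<odot>\<^bsub>D\<^esub> (f \<otimes>\<^bsub>D\<^esub> g)"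
      unfolding D unrestrict(2)[OF scale[OF a fg(2)] fg(1)]
      by (rule ext)
        (simp add: convolution_eq coproduct_closed tensor_form_scale_right[OF C C] fg a)
  qed (simp_all add: D convolution_linear convolution_extensional convolution_assoc)
qed

end

section \<open>The counit as unit of the dual\<close>

context counitary_coalgebra
begin

text \<open>Moving \<epsilon> from the forms to the tensor turns \<open>\<Delta> c\<close> into 1
  \<otimes> c or c \<otimes> 1 by the counit axioms, and the remaining pairing gives
  \<open>f c\<close>.\<close>

lemma convolution_counit:
  assumes f: "f \<in> linear_forms K C" and c: "c \<in> carrier C"
  shows "convolution K C \<Delta> \<epsilon> f c = f c" and "convolution K C \<Delta> f \<epsilon> c = f c"
proof -
  note C = module_axioms and G = scalars_module
  note \<Delta>c = coproduct_closed[OF c]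
  have fc: "f c \<in> carrier K" using linear_maps_closed[OF f c] by simp
  \<comment> \<open>The identity of \<open>K\<close> serves as a linear form on the ground module,
    so that \<epsilon> can be split off as a map into it.\<close>
  have "convolution K C \<Delta> \<epsilon> f c = tensor_form K (id \<circ> \<epsilon>) (f \<circ> id) (\<Delta> c)"
    by (simp add: convolution_eq c)
  also have "\<dots> = tensor_form K id f (pure_tensor K (ground_module K) C \<one>\<^bsub>K\<^esub> c)"
    using tensor_form_tensor_map[OF C C G C counit_linear linear_maps_id linear_maps_id f \<Delta>c]
    by (simp add: counit_left c)
  also have "\<dots> = f c" using tensor_form_pure[OF G C linear_maps_id f _ c] fc by simp
  finally show "convolution K C \<Delta> \<epsilon> f c = f c" .
  have "convolution K C \<Delta> f \<epsilon> c = tensor_form K (f \<circ> id) (id \<circ> \<epsilon>) (\<Delta> c)"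
    by (simp add: convolution_eq c)
  also have "\<dots> = tensor_form K f id (pure_tensor K C (ground_module K) c \<one>\<^bsub>K\<^esub>)"
    using tensor_form_tensor_map[OF C C C G linear_maps_id counit_linear f linear_maps_id \<Delta>c]
    by (simp add: counit_right c)
  also have "\<dots> = f c" using tensor_form_pure[OF C G f linear_maps_id c] fc by simp
  finally show "convolution K C \<Delta> f \<epsilon> c = f c" .
qed

lemma dual_algebra_monoid: "monoid (dual_algebra K C \<Delta> \<epsilon>)"
proof -
  have one: "convolution K C \<Delta> (restrict \<epsilon> (carrier C)) f = f"
    "convolution K C \<Delta> f (restrict \<epsilon> (carrier C)) = f"
    if f: "f \<in> linear_forms K C" "f \<in> extensional (carrier C)" for f
  proof -
    have "convolution K C \<Delta> (restrict \<epsilon> (carrier C)) f = convolution K C \<Delta> \<epsilon> f"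
      "convolution K C \<Delta> f (restrict \<epsilon> (carrier C)) = convolution K C \<Delta> f \<epsilon>"
      using counit_linear f by (auto intro!: convolution_cong)
    \<comment> \<open>The counit law gives equality on the carrier; extensionality of
      \<open>f\<close> makes it an equality of functions.\<close>
    moreover have "convolution K C \<Delta> \<epsilon> f = f" "convolution K C \<Delta> f \<epsilon> = f"
      using f by (auto intro!: extensionalityI[OF convolution_extensional] convolution_counit)
    ultimately show "convolution K C \<Delta> (restrict \<epsilon> (carrier C)) f = f"
      "convolution K C \<Delta> f (restrict \<epsilon> (carrier C)) = f" by simp_all
  qed
  show ?thesis
    by (rule monoidI)
      (simp_all add: dual_algebra_simps one convolution_linear convolution_extensional
        convolution_assoc restrict_linear counit_linear)
qed

end

section \<open>The dual of the Rota-Baxter operator\<close>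

context noncounitary_rota_baxter_coalgebra
begin

text \<open>Pairing the Rota-Baxter coidentity at \<open>c\<close> with f \<otimes> g and moving
  each \<open>P\<close> from the tensor to the forms gives the four terms. Evaluation at
  \<open>P c\<close> is the outer application of the dual operator.\<close>

lemma convolution_operator:
  assumes f: "f \<in> linear_forms K C" and g: "g \<in> linear_forms K C" and c: "c \<in> carrier C"
  shows "convolution K C \<Delta> (f \<circ> P) (g \<circ> P) c =
    convolution K C \<Delta> f (g \<circ> P) (P c) \<oplus>\<^bsub>K\<^esub> convolution K C \<Delta> (f \<circ> P) g (P c) \<oplus>\<^bsub>K\<^esub>
    weight \<otimes>\<^bsub>K\<^esub> convolution K C \<Delta> f g (P c)"
proof -
  note C = module_axioms and P = operator_linear
  interpret T: module K "tensor K C C" by (rule tensor_module[OF C C])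
  note fg = tensor_form_linear[OF C C f g]
  have Pc: "P c \<in> carrier C" by (rule linear_maps_closed[OF P c])
  note \<Delta>c = coproduct_closed[OF c] and \<Delta>Pc = coproduct_closed[OF Pc]
  note id = linear_maps_id[of K C]
  note mc = linear_maps_closed[OF tensor_map_linear[OF C C C C]]
  have "convolution K C \<Delta> (f \<circ> P) (g \<circ> P) c = tensor_form K f g (tensor_map K C C P P (\<Delta> c))"
    unfolding convolution_eq[OF c] by (rule tensor_form_tensor_map[OF C C C C P P f g \<Delta>c, symmetric])
  also have "\<dots> = tensor_form K f g (tensor_map K C C id P (\<Delta> (P c))) \<oplus>\<^bsub>K\<^esub>
      tensor_form K f g (tensor_map K C C P id (\<Delta> (P c))) \<oplus>\<^bsub>K\<^esub>
      weight \<otimes>\<^bsub>K\<^esub> tensor_form K f g (\<Delta> (P c))"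
    unfolding rota_baxter_coidentity[OF c]
    \<comment> \<open>The three summands must be known to lie in the tensor product before
      additivity of the pairing applies to them.\<close>
    using mc[OF id P \<Delta>Pc] mc[OF P id \<Delta>Pc] \<Delta>Pc weight_closed
    by (simp add: linear_maps_add[OF fg] linear_maps_smult[OF fg])
  also have "\<dots> = convolution K C \<Delta> f (g \<circ> P) (P c) \<oplus>\<^bsub>K\<^esub> convolution K C \<Delta> (f \<circ> P) g (P c) \<oplus>\<^bsub>K\<^esub>
      weight \<otimes>\<^bsub>K\<^esub> convolution K C \<Delta> f g (P c)"
    unfolding tensor_form_tensor_map[OF C C C C id P f g \<Delta>Pc]
      tensor_form_tensor_map[OF C C C C P id f g \<Delta>Pc] by (simp add: convolution_eq Pc)
  finally show ?thesis .
qed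

lemma dual_is_nonunitary_rota_baxter_algebra:
  assumes D: "carrier D = linear_forms K C \<inter> extensional (carrier C)"
    "zero D = (\<lambda>c \<in> carrier C. \<zero>\<^bsub>K\<^esub>)"
    "add D = (\<lambda>f g. \<lambda>c \<in> carrier C. f c \<oplus>\<^bsub>K\<^esub> g c)"
    "smult D = (\<lambda>a f. \<lambda>c \<in> carrier C. a \<otimes>\<^bsub>K\<^esub> f c)"
    "mult D = convolution K C \<Delta>"
  shows "nonunitary_rota_baxter_algebra K D (dual_map C P) weight"
proof (rule nonunitary_rota_baxter_algebra.intro[OF dual_is_nonunitary_algebra[OF D]
      nonunitary_rota_baxter_algebra_axioms.intro])
  have Pc: "P c \<in> carrier C" if "c \<in> carrier C" for c by (rule linear_maps_closed[OF operator_linear that])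
  have fP: "f \<circ> P \<in> linear_forms K C" if "f \<in> linear_forms K C" for f
    by (rule linear_maps_comp[OF operator_linear that])
  show "weight \<in> carrier K" by (rule weight_closed)
  \<comment> \<open>Since \<open>P\<close> preserves the carrier, the restrictions in the operations
    of \<open>D\<close> do not affect values at \<open>P c\<close>.\<close>
  show "dual_map C P \<in> linear_maps K D D"
    by (rule linear_mapsI) (auto simp: D dual_map_def Pc fP restrict_linear intro!: restrict_ext)
  fix f g assume "f \<in> carrier D" "g \<in> carrier D"
  then have f: "f \<in> linear_forms K C" and g: "g \<in> linear_forms K C" by (simp_all add: D)
  have unrestrict:
    "convolution K C \<Delta> (dual_map C P f) (dual_map C P g) = convolution K C \<Delta> (f \<circ> P) (g \<circ> P)"
    "convolution K C \<Delta> f (dual_map C P g) = convolution K C \<Delta> f (g \<circ> P)"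
    "convolution K C \<Delta> (dual_map C P f) g = convolution K C \<Delta> (f \<circ> P) g"
    using f g fP by (auto simp: dual_map_def intro!: convolution_cong)
  show "dual_map C P f \<otimes>\<^bsub>D\<^esub> dual_map C P g = dual_map C P (f \<otimes>\<^bsub>D\<^esub> dual_map C P g) \<oplus>\<^bsub>D\<^esub>
      dual_map C P (dual_map C P f \<otimes>\<^bsub>D\<^esub> g) \<oplus>\<^bsub>D\<^esub> weight \<odot>\<^bsub>D\<^esub> dual_map C P (f \<otimes>\<^bsub>D\<^esub> g)"
    unfolding D unrestrict
    \<comment> \<open>Both sides are extensional, so it remains to evaluate at a point of the
      carrier, where \<open>convolution_operator\<close> is the claim.\<close>
    by (rule extensionalityI[OF convolution_extensional restrict_extensional])
      (simp add: convolution_operator[OF f g] dual_map_def)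
qed

end

theorem proposition3p1:
  fixes K :: "('k, 'r) ring_scheme" and C :: "('k, 'c, 'm) module_scheme"
    and \<Delta> :: "'c \<Rightarrow> ('c \<times> 'c \<Rightarrow> 'k) set" and P :: "'c \<Rightarrow> 'c" and weight :: 'k
  assumes "field K"
    and "\<And>n::nat. n > 0 \<Longrightarrow> [n] \<cdot>\<^bsub>K\<^esub> \<one>\<^bsub>K\<^esub> \<noteq> \<zero>\<^bsub>K\<^esub>"
  shows "(\<forall>\<epsilon>. rota_baxter_coalgebra K C \<Delta> \<epsilon> P weight \<longrightarrow>
            rota_baxter_algebra K (dual_algebra K C \<Delta> \<epsilon>) (dual_map C P) weight) \<and>
         (noncounitary_rota_baxter_coalgebra K C \<Delta> P weight \<longrightarrow>
            nonunitary_rota_baxter_algebra K (nonunitary_dual_algebra K C \<Delta>) (dual_map C P) weight)"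
proof (intro conjI allI impI)
  fix \<epsilon> assume "rota_baxter_coalgebra K C \<Delta> \<epsilon> P weight"
  then interpret rota_baxter_coalgebra K C \<Delta> \<epsilon> P weight .
  show "rota_baxter_algebra K (dual_algebra K C \<Delta> \<epsilon>) (dual_map C P) weight"
    \<comment> \<open>Both dual records have the same module operations and product, so one lemma
      covers both cases; the counital case adds the unit laws.\<close>
    by (intro rota_baxter_algebra.intro dual_algebra_monoid dual_is_nonunitary_rota_baxter_algebra
        dual_algebra_simps)
next
  assume "noncounitary_rota_baxter_coalgebra K C \<Delta> P weight"
  then interpret noncounitary_rota_baxter_coalgebra K C \<Delta> P weight .
  show "nonunitary_rota_baxter_algebra K (nonunitary_dual_algebra K C \<Delta>) (dual_map C P) weight"
    by (intro dual_is_nonunitary_rota_baxter_algebra nonunitary_dual_algebra_simps)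
qed

end
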